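(* Let $K$ be a field, $R=K[x_1,\dots,x_n]$, and let $I\subset R$ be a (nonzero proper) monomial ideal without embedded associated primes with minimal irreducible decomposition $I=\mathfrak{q}_1\cap\cdots\cap\mathfrak{q}_r$, where $\mathfrak{q}_j=\langle x_i^{w_{j,i}} : i\in A_j\rangle$ with $A_j\subset[n]$ and $w_{j,i}$ positive integers. Let $$X_I=\{(k,l) : 1\le k<l\le r,\ \text{there exists } i\in A_k\cap A_l \text{ with } w_{k,i}\neq w_{l,i}\}.$$ Assume that $A_j\not\subset A_k\cup A_l$ for all $(k,l)\in X_I$ and every $j\in[r]\setminus\{k,l\}$. Then $I$ is a Simis ideal if and only if there exist a Simis squarefree monomial ideal $J\subset R$ and a standard linear weighting $w$ such that $I=J_w$.
   Context: $[m]=\{1,\dots,m\}$; $\mathbb{N}$ is the set of non-negative integers. For $a\in\mathbb{N}^n$, $x^a=x_1^{a_1}\cdots x_n^{a_n}$. Minimal irreducible decomposition: $I=\mathfrak{q}_1\cap\cdots\cap\mathfrak{q}_r$ where each $\mathfrak{q}_j$ is an irreducible monomial ideal (i.e. of the form $\langle x_i^{w_{j,i}} : i\in A_j\rangle$ with $\emptyset\ne A_j\subset[n]$, $w_{j,i}\ge1$), the radicals $\mathfrak{p}_j=\sqrt{\mathfrak{q}_j}=\langle x_i: i\in A_j\rangle$ are pairwise distinct, and the intersection is irredundant; thus $\mathrm{Ass}(I)=\{\mathfrak{p}_1,\dots,\mathfrak{p}_r\}$. It is assumed that $I$ admits such a decomposition. An embedded prime is an associated prime properly containing another associated prime; having none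 means $A_j\not\subset A_k$ for $j\neq k$. For $s\ge1$, $I^{(s)}=\bigcap_{\mathfrak{p}\in \mathrm{Ass}(I)}(I^sR_{\mathfrak{p}}\cap R)$. A monomial ideal $I$ is a Simis ideal if $I^{(s)}=I^s$ for all $s\ge1$. A standard linear weighting is a tuple $w=(w_1,\dots,w_n)$ of positive integers, acting by $w(a)=(w_1a_1,\dots,w_na_n)$; for a monomial ideal $J\subset R$, $J_w=\langle x^{w(a)} : x^a\in J\rangle$. *)

theory Defs
  imports
    "HOL-Library.Poly_Mapping"
    "HOL-Computational_Algebra.Fraction_Field"
    "HOL-Algebra.Algebra"
    "HOL-Algebra.Algebraic_Closure_Type"
begin

text \<open>
  The polynomial ring \<open>K[x\<^sub>1,\<dots>,x\<^sub>n]\<close>: the variables are indexed by a finite, linearly ordered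
  type \<open>'n\<close>, which plays the role of \<open>{1,\<dots>,n}\<close>; the order is used only for the
  \<open>idom\<close> instance of \<open>poly_mapping\<close>. An exponent vector is an element of \<open>'n \<Rightarrow>\<^sub>0 nat\<close>.
\<close>

type_synonym ('n, 'k) mpoly = "('n \<Rightarrow>\<^sub>0 nat) \<Rightarrow>\<^sub>0 'k"

text \<open>The whole type, viewed as a ring structure, so that ideals, prime ideals, generated ideals and
  products of ideals are those of HOL-Algebra.\<close>

abbreviation whole_ring :: "'a::comm_ring_1 ring" where
  "whole_ring \<equiv> ring_of_type_algebra"

abbreviation ideal_power :: "'a::comm_ring_1 set \<Rightarrow> nat \<Rightarrow> 'a set" where
  "ideal_power I s \<equiv> I [^]\<^bsub>ideals_set whole_ring\<^esub> s"

definition radical :: "'a::comm_ring_1 set \<Rightarrow> 'a set" where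
  "radical I = {f. \<exists>m\<ge>1. f ^ m \<in> I}"

definition associated_primes :: "'a::comm_ring_1 set \<Rightarrow> 'a set set" where
  "associated_primes I = {P. primeideal P whole_ring \<and> (\<exists>f. P = {g. g * f \<in> I})}"

definition embedded_primes :: "'a::comm_ring_1 set \<Rightarrow> 'a set set" where
  "embedded_primes I = {P \<in> associated_primes I. \<exists>Q \<in> associated_primes I. Q \<subset> P}"


subsection \<open>Symbolic powers\<close>

definition to_fraction :: "'a::idom \<Rightarrow> 'a fract" where
  "to_fraction f = Fraction_Field.Fract f 1"

text \<open>The localization \<open>R\<^sub>P\<close> of a domain \<open>R\<close> at a prime \<open>P\<close>, as a subring of the fraction field.\<close>

definition localization :: "'a::idom set \<Rightarrow> 'a fract ring" where
  "localization P = whole_ring\<lparr>carrier := {Fraction_Field.Fract a b | a b. b \<notin> P}\<rparr>"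

text \<open>The ideal \<open>I R\<^sub>P\<close> of \<open>R\<^sub>P\<close>, and its contraction \<open>I R\<^sub>P \<inter> R\<close>.\<close>

definition localized_ideal :: "'a::idom set \<Rightarrow> 'a set \<Rightarrow> 'a fract set" where
  "localized_ideal P I = Idl\<^bsub>localization P\<^esub> (to_fraction ` I)"

definition contracted_localization :: "'a::idom set \<Rightarrow> 'a set \<Rightarrow> 'a set" where
  "contracted_localization P I = {f. to_fraction f \<in> localized_ideal P I}"

definition symbolic_power :: "'a::idom set \<Rightarrow> nat \<Rightarrow> 'a set" where
  "symbolic_power I s =
     (\<Inter>P \<in> associated_primes I. contracted_localization P (ideal_power I s))"


subsection \<open>Monomial ideals\<close>

definition xpow :: "('n \<Rightarrow>\<^sub>0 nat) \<Rightarrow> ('n, 'k::field) mpoly" where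
  "xpow a = Poly_Mapping.single a 1"

definition monomial_ideal :: "('n, 'k::field) mpoly set \<Rightarrow> bool" where
  "monomial_ideal I \<longleftrightarrow> (\<exists>S. I = Idl\<^bsub>whole_ring\<^esub> (xpow ` S))"

definition squarefree_monomial_ideal :: "('n, 'k::field) mpoly set \<Rightarrow> bool" where
  "squarefree_monomial_ideal I \<longleftrightarrow>
     (\<exists>S. (\<forall>a\<in>S. \<forall>i. Poly_Mapping.lookup a i \<le> 1) \<and> I = Idl\<^bsub>whole_ring\<^esub> (xpow ` S))"

definition simis_ideal :: "('n::linorder, 'k::field) mpoly set \<Rightarrow> bool" where
  "simis_ideal I \<longleftrightarrow> monomial_ideal I \<and> (\<forall>s\<ge>1. symbolic_power I s = ideal_power I s)"

text \<open>The ideal generated by the pure powers \<open>x\<^sub>i ^ u i\<close> with \<open>i \<in> A\<close>.\<close>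

definition pure_power_ideal :: "'n set \<Rightarrow> ('n \<Rightarrow> nat) \<Rightarrow> ('n, 'k::field) mpoly set" where
  "pure_power_ideal A u = Idl\<^bsub>whole_ring\<^esub> ((\<lambda>i. xpow (Poly_Mapping.single i (u i))) ` A)"

text \<open>The values \<open>u j i\<close> with \<open>i \<notin> A j\<close> play no role.\<close>

definition minimal_irreducible_decomposition ::
  "('n, 'k::field) mpoly set \<Rightarrow> nat \<Rightarrow> (nat \<Rightarrow> 'n set) \<Rightarrow> (nat \<Rightarrow> 'n \<Rightarrow> nat) \<Rightarrow> bool" where
  "minimal_irreducible_decomposition I r A u \<longleftrightarrow>
     (\<forall>j\<in>{1..r}. A j \<noteq> {} \<and> (\<forall>i\<in>A j. u j i \<ge> 1)) \<and>
     I = (\<Inter>j\<in>{1..r}. pure_power_ideal (A j) (u j)) \<and>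
     inj_on (\<lambda>j. radical (pure_power_ideal (A j) (u j) :: ('n, 'k) mpoly set)) {1..r} \<and>
     (\<forall>k\<in>{1..r}. I \<noteq> (\<Inter>j\<in>{1..r} - {k}. pure_power_ideal (A j) (u j)))"


subsection \<open>Standard linear weightings\<close>

definition standard_weighting :: "('n \<Rightarrow> nat) \<Rightarrow> bool" where
  "standard_weighting w \<longleftrightarrow> (\<forall>i. w i > 0)"

definition weight_exponent :: "('n \<Rightarrow> nat) \<Rightarrow> ('n \<Rightarrow>\<^sub>0 nat) \<Rightarrow> ('n \<Rightarrow>\<^sub>0 nat)" where
  "weight_exponent w a = Poly_Mapping.mapp (\<lambda>i c. w i * c) a"

definition weighted_ideal :: "('n \<Rightarrow> nat) \<Rightarrow> ('n, 'k::field) mpoly set \<Rightarrow> ('n, 'k) mpoly set" where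
  "weighted_ideal w J = Idl\<^bsub>whole_ring\<^esub> {xpow (weight_exponent w a) | a. xpow a \<in> J}"

text \<open>The set \<open>X\<^sub>I\<close> of pairs of components in which some variable occurs with different exponents.\<close>

definition weight_conflicts ::
  "nat \<Rightarrow> (nat \<Rightarrow> 'n set) \<Rightarrow> (nat \<Rightarrow> 'n \<Rightarrow> nat) \<Rightarrow> (nat \<times> nat) set" where
  "weight_conflicts r A u =
     {(k, l). 1 \<le> k \<and> k < l \<and> l \<le> r \<and> (\<exists>i \<in> A k \<inter> A l. u k i \<noteq> u l i)}"

end

theory Submission
  imports Defs
begin

text \<open>
  For a family of irreducible monomial ideals with pairwise incomparable variable sets \<open>A j\<close>, the
  \<open>s\<close>-th symbolic power of the intersection is the intersection of the \<open>s\<close>-th powers, so \<open>x^b\<close> lies in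
  it iff \<open>s \<le> (\<Sum>i\<in>A j. b i div u j i)\<close> for all \<open>j\<close>; hence the Simis property is a statement
  about sets of exponents. If two components disagree on the weight of a common variable, the
  hypothesis on the sets \<open>A j\<close> allows one to make the other components irrelevant, and a monomial in
  two variables separates the symbolic square from the square. So a Simis ideal has a common weight
  \<open>w i\<close> for each variable, and the map \<open>b \<mapsto> b div w\<close> translates between the powers of the
  ideal and those of its radical.
\<close>

subsection \<open>Ideals of the whole ring and contractions from localizations\<close>

text \<open>Associated primes are colon ideals by arbitrary polynomials, so they are not known in
  advance to be generated by variables. Two partial facts replace a classification: the variables of
  each component generate an associated prime, and the variables contained in any associated prime
  all belong to a single \<open>A j\<close>. Absence of embedded primes enters as incomparability of
  the sets \<open>A j\<close>: it supplies, for each component, a monomial free of its variables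
  that lies in all the others. This monomial becomes a unit at the prime of that component, so the
  others disappear there. For a conflicting pair the same device needs a monomial free of
  \<open>A k \<union> A l\<close>, and this is what the hypothesis on conflicts provides. In the
  converse direction \<open>I = J_w\<close> displays no decomposition of \<open>J\<close>, while
  symbolic powers are computed from a decomposition. Hence \<open>J\<close> is first identified with
  the radical of \<open>I\<close>, and \<open>w\<close> with the weights \<open>u j\<close> on each
  \<open>A j\<close>.\<close>

lemma whole_ring_simps:
  "carrier whole_ring = UNIV" "\<zero>\<^bsub>whole_ring\<^esub> = 0" "\<one>\<^bsub>whole_ring\<^esub> = 1"
  "x \<oplus>\<^bsub>whole_ring\<^esub> y = x + y" "x \<otimes>\<^bsub>whole_ring\<^esub> y = x * y"
  by (simp_all add: ring_of_type_algebra_def)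

text \<open>Closure of \<open>I\<close> under negation comes from multiplication by
  \<open>- 1\<close>, which lies in \<open>C\<close>. The carrier is left general so that one
  criterion covers both the whole ring (\<open>C = UNIV\<close>) and a localization inside the
  fraction field.\<close>

lemma ideal_carrier_update_iff:
  fixes C :: "'a::comm_ring_1 set"
  assumes C: "1 \<in> C" "\<And>x. x \<in> C \<Longrightarrow> - x \<in> C"
    "\<And>x y. x \<in> C \<Longrightarrow> y \<in> C \<Longrightarrow> x + y \<in> C" "\<And>x y. x \<in> C \<Longrightarrow> y \<in> C \<Longrightarrow> x * y \<in> C"
  shows "ideal I (whole_ring\<lparr>carrier := C\<rparr>) \<longleftrightarrow>
    I \<subseteq> C \<and> 0 \<in> I \<and> (\<forall>a\<in>I. \<forall>b\<in>I. a + b \<in> I) \<and> (\<forall>a\<in>I. \<forall>x\<in>C. x * a \<in> I)"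
    (is "?L \<longleftrightarrow> ?R")
proof
  interpret W: ring "whole_ring :: 'a ring" by (rule ring_from_type_algebra)
  have neg: "\<ominus>\<^bsub>whole_ring\<^esub> x = - x" for x :: 'a
    by (rule W.minus_equality) (simp_all add: whole_ring_simps)
  have "subring C whole_ring"
    by (rule W.subringI) (use C in \<open>auto simp: whole_ring_simps neg\<close>)
  then have R: "ring (whole_ring\<lparr>carrier := C\<rparr>)"
    by (rule W.subring_is_ring)
  {
    assume ?L
    then interpret I: ideal I "whole_ring\<lparr>carrier := C\<rparr>" .
    show ?R
      using I.a_subset additive_subgroup.zero_closed[OF I.additive_subgroup_axioms]
        additive_subgroup.a_closed[OF I.additive_subgroup_axioms] I.I_l_closed
      by (simp add: whole_ring_simps)
  next
    assume r: ?R
    interpret R: ring "whole_ring\<lparr>carrier := C\<rparr>" by (rule R)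
    show ?L
    proof (rule idealI[OF R])
      show "subgroup I (add_monoid (whole_ring\<lparr>carrier := C\<rparr>))"
      proof (rule R.add.subgroupI)
        show "I \<subseteq> carrier (whole_ring\<lparr>carrier := C\<rparr>)" "I \<noteq> {}"
          using r by auto
      next
        fix a assume a: "a \<in> I"
        have "- 1 * a \<in> I"
          using r a C(1,2) by blast
        moreover have "\<ominus>\<^bsub>whole_ring\<lparr>carrier := C\<rparr>\<^esub> a = - a"
          by (rule R.minus_equality) (use a r C(2) in \<open>auto simp: whole_ring_simps\<close>)
        ultimately show "\<ominus>\<^bsub>whole_ring\<lparr>carrier := C\<rparr>\<^esub> a \<in> I"
          by simp
      next
        fix a b assume "a \<in> I" "b \<in> I"
        then show "a \<oplus>\<^bsub>whole_ring\<lparr>carrier := C\<rparr>\<^esub> b \<in> I"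
          using r by (simp add: whole_ring_simps)
      qed
    qed (use r in \<open>auto simp: whole_ring_simps mult.commute\<close>)
  }
qed

lemma ideal_whole_ring_iff:
  fixes I :: "'a::comm_ring_1 set"
  shows "ideal I whole_ring \<longleftrightarrow>
    0 \<in> I \<and> (\<forall>a\<in>I. \<forall>b\<in>I. a + b \<in> I) \<and> (\<forall>a\<in>I. \<forall>x. x * a \<in> I)"
proof -
  have "(whole_ring :: 'a ring)\<lparr>carrier := UNIV\<rparr> = whole_ring"
    by (simp add: ring_of_type_algebra_def)
  then show ?thesis
    using ideal_carrier_update_iff[of UNIV I] by simp
qed

lemma primeideal_whole_ring_iff:
  fixes P :: "'a::comm_ring_1 set"
  shows "primeideal P whole_ring \<longleftrightarrow>
    ideal P whole_ring \<and> 1 \<notin> P \<and> (\<forall>a b. a * b \<in> P \<longrightarrow> a \<in> P \<or> b \<in> P)"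
    (is "?L \<longleftrightarrow> ?R")
proof
  assume ?L
  then interpret P: primeideal P whole_ring .
  have "P \<noteq> UNIV"
    using P.I_notcarr by (auto simp: whole_ring_simps)
  moreover have "P = UNIV" if "1 \<in> P"
    using that P.ideal_axioms unfolding ideal_whole_ring_iff by (metis UNIV_eq_I mult.right_neutral)
  ultimately show ?R
    using P.ideal_axioms P.I_prime by (auto simp: whole_ring_simps)
next
  assume r: ?R
  show ?L
    by (rule primeidealI) (use r cring_from_type_algebra in \<open>auto simp: whole_ring_simps\<close>)
qed

lemma genideal_whole_ring_minimal:
  assumes "ideal I whole_ring" "S \<subseteq> I"
  shows "Idl\<^bsub>whole_ring\<^esub> S \<subseteq> I"
  unfolding genideal_def using assms by auto

text \<open>The fractions \<open>a / b\<close> with \<open>a\<close> in \<open>I\<close> and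
  \<open>b\<close> outside \<open>P\<close> form an ideal of the localization containing the image
  of \<open>I\<close>; conversely \<open>f = (1 / t) * (t * f)\<close>. This trades fractions for
  multipliers \<open>t\<close> outside \<open>P\<close>.\<close>

lemma contracted_localization_eq:
  fixes P I :: "'a::idom set"
  assumes P: "primeideal P whole_ring" and I: "ideal I whole_ring"
  shows "contracted_localization P I = {f. \<exists>t. t \<notin> P \<and> t * f \<in> I}"
proof -
  define C where "C = {Fraction_Field.Fract a b | a b :: 'a. b \<notin> P}"
  define M where "M = {Fraction_Field.Fract a b | a b. a \<in> I \<and> b \<notin> P}"
  have zP: "0 \<in> P" and oP: "1 \<notin> P" and nP: "\<And>a b. a \<notin> P \<Longrightarrow> b \<notin> P \<Longrightarrow> a * b \<notin> P"
    using P by (auto simp: primeideal_whole_ring_iff ideal_whole_ring_iff)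
  then have nz: "\<And>b. b \<notin> P \<Longrightarrow> b \<noteq> 0" by metis
  have I': "0 \<in> I" "\<And>a b. a \<in> I \<Longrightarrow> b \<in> I \<Longrightarrow> a + b \<in> I" "\<And>a x. a \<in> I \<Longrightarrow> x * a \<in> I"
    using I by (auto simp: ideal_whole_ring_iff)
  have loc: "localization P = whole_ring\<lparr>carrier := C\<rparr>"
    by (simp add: localization_def C_def)
  have id_iff: "ideal K (localization P) \<longleftrightarrow>
    K \<subseteq> C \<and> 0 \<in> K \<and> (\<forall>a\<in>K. \<forall>b\<in>K. a + b \<in> K) \<and> (\<forall>a\<in>K. \<forall>x\<in>C. x * a \<in> K)" for K
    unfolding loc
  proof (rule ideal_carrier_update_iff)
    show "1 \<in> C"
      unfolding C_def using oP by (auto simp: One_fract_def)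
    show "- x \<in> C" if "x \<in> C" for x
      using that unfolding C_def by (auto, metis)
    show "x + y \<in> C" if "x \<in> C" "y \<in> C" for x y
      using that nP nz unfolding C_def by (fastforce simp: add_fract)
    show "x * y \<in> C" if "x \<in> C" "y \<in> C" for x y
      using that nP unfolding C_def by (fastforce simp: mult_fract)
  qed
  have "ideal M (localization P)"
    unfolding id_iff
  proof (intro conjI ballI)
    show "M \<subseteq> C" by (auto simp: M_def C_def)
    show "0 \<in> M"
      unfolding M_def using I'(1) oP by (auto simp: Zero_fract_def)
    show "x + y \<in> M" if xy: "x \<in> M" "y \<in> M" for x y
    proof -
      obtain a b c d where "x = Fraction_Field.Fract a b" "y = Fraction_Field.Fract c d"
        "a \<in> I" "c \<in> I" "b \<notin> P" "d \<notin> P"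
        using xy by (auto simp: M_def)
      moreover from this have "a * d + c * b \<in> I"
        using I'(2,3) by (metis mult.commute)
      ultimately show ?thesis
        unfolding M_def using nP nz by (fastforce simp: add_fract)
    qed
    show "y * x \<in> M" if "x \<in> M" "y \<in> C" for x y
      using that nP I'(3) unfolding M_def C_def by (fastforce simp: mult_fract)
  qed
  moreover have "to_fraction ` I \<subseteq> M"
    using oP by (auto simp: M_def to_fraction_def)
  ultimately have 1: "localized_ideal P I \<subseteq> M"
    by (auto simp: localized_ideal_def genideal_def)
  have 2: "to_fraction f \<in> localized_ideal P I" if f: "t * f \<in> I" "t \<notin> P" for f t
    unfolding localized_ideal_def genideal_def
  proof (clarsimp simp: id_iff)
    fix K assume K: "to_fraction ` I \<subseteq> K" "\<forall>a\<in>K. \<forall>x\<in>C. x * a \<in> K"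
    have "Fraction_Field.Fract 1 t * to_fraction (t * f) \<in> K"
    proof -
      have "Fraction_Field.Fract 1 t \<in> C" "to_fraction (t * f) \<in> K"
        using K(1) f by (auto simp: C_def)
      then show ?thesis using K(2) by blast
    qed
    also have "Fraction_Field.Fract 1 t * to_fraction (t * f) = to_fraction f"
      using nz[OF f(2)] by (simp add: to_fraction_def mult_fract eq_fract)
    finally show "to_fraction f \<in> K" .
  qed
  have 3: "\<exists>t. t \<notin> P \<and> t * f \<in> I" if f: "to_fraction f \<in> M" for f
  proof -
    obtain a b where "to_fraction f = Fraction_Field.Fract a b" "a \<in> I" "b \<notin> P"
      using f unfolding M_def by blast
    then show ?thesis
      using nz by (auto simp: to_fraction_def eq_fract mult.commute)
  qed
  show ?thesis
    unfolding contracted_localization_def using 1 2 3 by blast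
qed

lemma ideal_power_0: "ideal_power I 0 = (UNIV :: 'a::comm_ring_1 set)"
  by (simp add: ideals_set_def nat_pow_def whole_ring_simps)

lemma ideal_power_Suc:
  "ideal_power I (Suc s) = ideal_prod whole_ring (ideal_power I s) (I :: 'a::comm_ring_1 set)"
  by (simp add: ideals_set_def nat_pow_def)

subsection \<open>Monomial ideals as spans of up-closed sets of exponents\<close>

definition monomial_span :: "('n \<Rightarrow>\<^sub>0 nat) set \<Rightarrow> ('n, 'k::field) mpoly set" where
  "monomial_span U = {f. Poly_Mapping.keys f \<subseteq> U}"

definition up_closed :: "('n \<Rightarrow>\<^sub>0 nat) set \<Rightarrow> bool" where
  "up_closed U \<longleftrightarrow> (\<forall>a\<in>U. \<forall>c. a + c \<in> U)"

definition up_closure :: "('n \<Rightarrow>\<^sub>0 nat) set \<Rightarrow> ('n \<Rightarrow>\<^sub>0 nat) set" where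
  "up_closure S = {a + c | a c. a \<in> S}"

text \<open>The start value is \<open>UNIV\<close>, the exponents of the unit ideal, and not
  \<open>{0}\<close>; thus every stage is again up-closed when \<open>U\<close> is.\<close>

primrec sum_power :: "('n \<Rightarrow>\<^sub>0 nat) set \<Rightarrow> nat \<Rightarrow> ('n \<Rightarrow>\<^sub>0 nat) set" where
  "sum_power U 0 = UNIV"
| "sum_power U (Suc s) = {a + b | a b. a \<in> sum_power U s \<and> b \<in> U}"

lemma exponent_le_imp_add:
  fixes a b :: "'n \<Rightarrow>\<^sub>0 nat"
  assumes "\<And>i. Poly_Mapping.lookup a i \<le> Poly_Mapping.lookup b i"
  obtains c where "b = a + c"
proof
  show "b = a + (b - a)"
    by (rule poly_mapping_eqI) (use assms in \<open>simp add: lookup_add lookup_minus\<close>)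
qed

lemma up_closedD:
  assumes "up_closed U" "a \<in> U" "\<And>i. Poly_Mapping.lookup a i \<le> Poly_Mapping.lookup b i"
  shows "b \<in> U"
  using exponent_le_imp_add[of a b] assms unfolding up_closed_def by metis

lemma up_closure_iff:
  "b \<in> up_closure S \<longleftrightarrow> (\<exists>a\<in>S. \<forall>i. Poly_Mapping.lookup a i \<le> Poly_Mapping.lookup b i)"
proof
  assume "b \<in> up_closure S"
  then show "\<exists>a\<in>S. \<forall>i. Poly_Mapping.lookup a i \<le> Poly_Mapping.lookup b i"
    by (force simp: up_closure_def lookup_add)
next
  assume "\<exists>a\<in>S. \<forall>i. Poly_Mapping.lookup a i \<le> Poly_Mapping.lookup b i"
  then obtain a where a: "a \<in> S" "\<And>i. Poly_Mapping.lookup a i \<le> Poly_Mapping.lookup b i"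
    by auto
  obtain c where "b = a + c"
    using exponent_le_imp_add[OF a(2)] .
  then show "b \<in> up_closure S"
    using a(1) by (auto simp: up_closure_def)
qed

lemma up_closed_up_closure: "up_closed (up_closure S)"
  unfolding up_closed_def Ball_def up_closure_iff lookup_add Bex_def by (meson trans_le_add1)

lemma up_closure_up_closed: "up_closed U \<Longrightarrow> up_closure U = U"
  using up_closedD[of U] by (auto simp: up_closure_iff)

lemma up_closed_sum_power:
  assumes "up_closed U"
  shows "up_closed (sum_power U s)"
proof (cases s)
  case 0
  then show ?thesis by (simp add: up_closed_def)
next
  case (Suc m)
  have "a + b + c \<in> sum_power U s" if "a \<in> sum_power U m" "b \<in> U" for a b c
    using that assms unfolding Suc up_closed_def by (auto simp: add.assoc)
  then show ?thesis
    unfolding up_closed_def Suc by auto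
qed

lemma xpow_in_monomial_span [simp]: "xpow a \<in> monomial_span U \<longleftrightarrow> a \<in> U"
  by (simp add: xpow_def monomial_span_def)

lemma monomial_span_eq_iff [simp]:
  "(monomial_span U :: ('n, 'k::field) mpoly set) = monomial_span V \<longleftrightarrow> U = V"
proof
  assume eq: "(monomial_span U :: ('n, 'k) mpoly set) = monomial_span V"
  have "a \<in> U \<longleftrightarrow> a \<in> V" for a
  proof -
    have "(xpow a :: ('n, 'k) mpoly) \<in> monomial_span U \<longleftrightarrow> (xpow a :: ('n, 'k) mpoly) \<in> monomial_span V"
      by (simp only: eq)
    then show ?thesis by simp
  qed
  then show "U = V" by auto
qed simp

lemma xpow_0 [simp]: "xpow 0 = 1"
  by (simp add: xpow_def)

lemma xpow_add: "xpow (a + b) = xpow a * xpow b"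
  by (simp add: xpow_def mult_single)

lemma ideal_monomial_span:
  assumes "up_closed U"
  shows "ideal (monomial_span U) whole_ring"
  unfolding ideal_whole_ring_iff
proof (intro conjI ballI allI)
  show "0 \<in> monomial_span U"
    by (simp add: monomial_span_def)
  show "f + g \<in> monomial_span U" if "f \<in> monomial_span U" "g \<in> monomial_span U"
    for f g :: "('a, 'b) mpoly"
    using that Poly_Mapping.keys_add[of f g] by (auto simp: monomial_span_def)
  show "h * f \<in> monomial_span U" if "f \<in> monomial_span U" for f h :: "('a, 'b) mpoly"
    unfolding monomial_span_def
  proof clarify
    fix c assume "c \<in> Poly_Mapping.keys (h * f)"
    then obtain a b where "c = b + a" "b \<in> Poly_Mapping.keys f"
      using keys_mult[of h f] by (auto simp: add.commute)
    then show "c \<in> U"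
      using that assms by (auto simp: monomial_span_def up_closed_def)
  qed
qed

lemma monomial_span_subsetI:
  fixes D :: "('n, 'k::field) mpoly set"
  assumes "0 \<in> D" "\<And>f g. f \<in> D \<Longrightarrow> g \<in> D \<Longrightarrow> f + g \<in> D"
    and "\<And>a c. a \<in> U \<Longrightarrow> Poly_Mapping.single a c \<in> D"
  shows "monomial_span U \<subseteq> D"
proof
  fix f :: "('n, 'k) mpoly" assume f: "f \<in> monomial_span U"
  have sum: "sum g F \<in> D" if "finite F" "\<forall>a\<in>F. g a \<in> D" for g F
    using that by (induction F rule: finite_induct) (use assms(1,2) in auto)
  have "f = (\<Sum>a\<in>Poly_Mapping.keys f. Poly_Mapping.single a (Poly_Mapping.lookup f a))"
    by (rule poly_mapping_eqI) (auto simp: lookup_sum lookup_single when_def in_keys_iff)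
  also have "\<dots> \<in> D"
    by (rule sum) (use f assms(3) in \<open>auto simp: monomial_span_def\<close>)
  finally show "f \<in> D" .
qed

lemma genideal_xpow:
  "Idl\<^bsub>whole_ring\<^esub> (xpow ` S) = (monomial_span (up_closure S) :: ('n, 'k::field) mpoly set)"
proof
  show "Idl\<^bsub>whole_ring\<^esub> (xpow ` S :: ('n, 'k) mpoly set) \<subseteq> monomial_span (up_closure S)"
    by (rule genideal_whole_ring_minimal)
      (auto simp: up_closed_up_closure up_closure_iff intro: ideal_monomial_span)
next
  show "monomial_span (up_closure S) \<subseteq> Idl\<^bsub>whole_ring\<^esub> (xpow ` S :: ('n, 'k) mpoly set)"
    unfolding genideal_def
  proof (rule Inter_greatest)
    fix I :: "('n, 'k) mpoly set"
    assume "I \<in> {I. ideal I whole_ring \<and> xpow ` S \<subseteq> I}"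
    then have I: "ideal I whole_ring" "xpow ` S \<subseteq> I" by auto
    show "monomial_span (up_closure S) \<subseteq> I"
    proof (rule monomial_span_subsetI)
      fix b :: "'n \<Rightarrow>\<^sub>0 nat" and k :: 'k assume "b \<in> up_closure S"
      then obtain a c where ac: "b = a + c" "a \<in> S" by (auto simp: up_closure_def)
      have "Poly_Mapping.single c k * xpow a \<in> I"
        using I ac(2) by (auto simp: ideal_whole_ring_iff)
      then show "Poly_Mapping.single b k \<in> I"
        by (simp add: xpow_def mult_single ac(1) add.commute)
    qed (use I in \<open>auto simp: ideal_whole_ring_iff\<close>)
  qed
qed

lemma monomial_ideal_monomial_span: "up_closed U \<Longrightarrow> monomial_ideal (monomial_span U)"
  unfolding monomial_ideal_def by (metis genideal_xpow up_closure_up_closed)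

lemma ideal_prod_monomial_span:
  assumes "up_closed U" "up_closed V"
  shows "ideal_prod whole_ring (monomial_span U) (monomial_span V :: ('n, 'k::field) mpoly set) =
    monomial_span {a + b | a b. a \<in> U \<and> b \<in> V}" (is "?P = monomial_span ?W")
proof
  show "?P \<subseteq> monomial_span ?W"
  proof
    fix h assume "h \<in> ?P"
    then show "h \<in> monomial_span ?W"
    proof induction
      case (prod f g)
      then show ?case
        using keys_mult[of f g] by (fastforce simp: monomial_span_def whole_ring_simps)
    next
      case (sum f g)
      then show ?case
        using Poly_Mapping.keys_add[of f g] by (auto simp: monomial_span_def whole_ring_simps)
    qed
  qed
next
  have 0: "ideal ?P whole_ring"
    by (intro ring.ideal_prod_is_ideal ring_from_type_algebra ideal_monomial_span assms)
  show "monomial_span ?W \<subseteq> ?P"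
  proof (rule monomial_span_subsetI)
    fix c :: "'n \<Rightarrow>\<^sub>0 nat" and k :: 'k assume "c \<in> ?W"
    then obtain a b where ab: "c = a + b" "a \<in> U" "b \<in> V" by auto
    have "Poly_Mapping.single a k \<otimes>\<^bsub>whole_ring\<^esub> Poly_Mapping.single b 1 \<in> ?P"
      by (rule ideal_prod.prod) (use ab in \<open>auto simp: monomial_span_def\<close>)
    then show "Poly_Mapping.single c k \<in> ?P"
      by (simp add: whole_ring_simps mult_single ab(1))
  qed (use 0 in \<open>auto simp: ideal_whole_ring_iff\<close>)
qed

lemma ideal_power_monomial_span:
  assumes "up_closed U"
  shows "ideal_power (monomial_span U) s = monomial_span (sum_power U s)"
proof (induction s)
  case 0
  show ?case unfolding ideal_power_0 by (simp add: monomial_span_def)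
next
  case (Suc s)
  show ?case
    unfolding ideal_power_Suc Suc
    using ideal_prod_monomial_span[OF up_closed_sum_power[OF assms] assms] by simp
qed

section \<open>Primes and cancellation modulo monomial ideals\<close>

text \<open>Splitting off one variable at a time, primality puts either the variable or the smaller
  monomial into \<open>P\<close>. Contrapositively, a monomial in variables outside \<open>P\<close>
  is an admissible multiplier at \<open>P\<close>.\<close>

lemma prime_contains_variable:
  fixes P :: "('n::{finite,linorder}, 'k::field) mpoly set"
  assumes "primeideal P whole_ring" "xpow t \<in> P"
  shows "\<exists>i. Poly_Mapping.lookup t i > 0 \<and> xpow (Poly_Mapping.single i 1) \<in> P"
  using assms(2)
proof (induction "\<Sum>i\<in>UNIV. Poly_Mapping.lookup t i" arbitrary: t rule: less_induct)
  case less
  have P: "1 \<notin> P" "\<And>a b. a * b \<in> P \<Longrightarrow> a \<in> P \<or> b \<in> P"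
    using assms(1) unfolding primeideal_whole_ring_iff by blast+
  have "t \<noteq> 0"
    using P(1) less.prems by auto
  then obtain i where i: "Poly_Mapping.lookup t i > 0"
    by (metis neq0_conv poly_mapping_eqI lookup_zero)
  obtain t' where t': "t = Poly_Mapping.single i 1 + t'"
    by (rule exponent_le_imp_add[of "Poly_Mapping.single i 1" t])
      (use i in \<open>auto simp: lookup_single when_def\<close>)
  show ?case
  proof (cases "xpow (Poly_Mapping.single i 1) \<in> P")
    case True
    then show ?thesis using i by auto
  next
    case False
    then have "xpow t' \<in> P"
      using P(2) less.prems unfolding t' xpow_add by blast
    moreover have "(\<Sum>i\<in>UNIV. Poly_Mapping.lookup t' i) < (\<Sum>i\<in>UNIV. Poly_Mapping.lookup t i)"
      unfolding t' by (rule sum_strict_mono_ex1) (auto simp: lookup_add intro!: exI[of _ i])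
    ultimately obtain i' where "Poly_Mapping.lookup t' i' > 0" "xpow (Poly_Mapping.single i' 1) \<in> P"
      using less.hyps by blast
    then show ?thesis
      unfolding t' by (auto simp: lookup_add)
  qed
qed

text \<open>A monomial of \<open>f\<close> outside \<open>Q\<close> with smallest degree in the variables of \<open>A\<close> cannot be
  cancelled in \<open>t * f\<close>: the part of \<open>t\<close> free of \<open>A\<close> and the part of \<open>f\<close> that agrees with that
  monomial on \<open>A\<close> have a nonzero product, and no other terms contribute to it.\<close>

lemma monomial_span_primary:
  fixes f t :: "('n::{finite,linorder}, 'k::field) mpoly"
  assumes Q: "up_closed Q"
    and Q_A: "\<And>a b. a \<in> Q \<Longrightarrow> (\<And>i. i \<in> A \<Longrightarrow> Poly_Mapping.lookup a i = Poly_Mapping.lookup b i) \<Longrightarrow> b \<in> Q"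
    and t: "e \<in> Poly_Mapping.keys t" "\<And>i. i \<in> A \<Longrightarrow> Poly_Mapping.lookup e i = 0"
    and tf: "t * f \<in> monomial_span Q"
  shows "f \<in> monomial_span Q"
proof (rule ccontr)
  assume "f \<notin> monomial_span Q"
  then have ex: "\<exists>a. a \<in> Poly_Mapping.keys f \<and> a \<notin> Q" by (auto simp: monomial_span_def)
  define deg where "deg a = (\<Sum>i\<in>A. Poly_Mapping.lookup a i)" for a :: "'n \<Rightarrow>\<^sub>0 nat"
  obtain \<alpha> where \<alpha>: "\<alpha> \<in> Poly_Mapping.keys f" "\<alpha> \<notin> Q"
    and min: "\<And>b. b \<in> Poly_Mapping.keys f \<Longrightarrow> b \<notin> Q \<Longrightarrow> deg \<alpha> \<le> deg b"
    using ex_has_least_nat[of "\<lambda>a. a \<in> Poly_Mapping.keys f \<and> a \<notin> Q" _ deg] ex by blast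
  define E where "E = {a. \<forall>i\<in>A. Poly_Mapping.lookup a i = Poly_Mapping.lookup \<alpha> i}"
  define Z where "Z = {a :: 'n \<Rightarrow>\<^sub>0 nat. \<forall>i\<in>A. Poly_Mapping.lookup a i = 0}"
  define part :: "('n \<Rightarrow>\<^sub>0 nat) set \<Rightarrow> ('n, 'k) mpoly \<Rightarrow> ('n, 'k) mpoly"
    where "part D = Poly_Mapping.mapp (\<lambda>a c. if a \<in> D then c else 0)" for D
  have lookup_part: "Poly_Mapping.lookup (part D g) a =
      (if a \<in> D then Poly_Mapping.lookup g a else 0)" for D g a
    by (auto simp: part_def lookup_mapp when_def in_keys_iff)
  have keys_part: "Poly_Mapping.keys (part D g) = Poly_Mapping.keys g \<inter> D" for D g
    by (auto simp: in_keys_iff lookup_part split: if_splits)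
  have keys_rest: "Poly_Mapping.keys (g - part D g) = Poly_Mapping.keys g - D" for D g
    by (auto simp: in_keys_iff lookup_part lookup_minus split: if_splits)
  have "part Z t \<noteq> 0" "part E f \<noteq> 0"
    using t \<alpha>(1) keys_part[of Z t] keys_part[of E f] by (auto simp: Z_def E_def)
  \<comment> \<open>The polynomial ring has no zero divisors, so some term \<open>c\<close>
    survives; it agrees with \<open>\<alpha>\<close> on \<open>A\<close> and therefore avoids
    \<open>Q\<close>.\<close>
  then have "part Z t * part E f \<noteq> 0" by simp
  then obtain c where c: "c \<in> Poly_Mapping.keys (part Z t * part E f)"
    by (metis poly_mapping_eqI in_keys_iff lookup_zero)
  then have cE: "c \<in> E"
    using keys_mult[of "part Z t" "part E f"] unfolding keys_part
    by (auto simp: Z_def E_def lookup_add)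
  have cQ: "c \<notin> Q"
    using Q_A[of c \<alpha>] cE \<alpha>(2) by (auto simp: E_def)
  have "c \<notin> Poly_Mapping.keys (part Z t * (f - part E f))"
  proof
    assume "c \<in> Poly_Mapping.keys (part Z t * (f - part E f))"
    then obtain a b where "c = a + b" "a \<in> Z" "b \<notin> E"
      using keys_mult[of "part Z t" "f - part E f"] unfolding keys_part keys_rest by auto
    then show False
      using cE by (auto simp: Z_def E_def lookup_add)
  qed
  moreover have "c \<notin> Poly_Mapping.keys ((t - part Z t) * f)"
  proof
    assume "c \<in> Poly_Mapping.keys ((t - part Z t) * f)"
    then obtain a b where ab: "c = a + b" "a \<notin> Z" "b \<in> Poly_Mapping.keys f"
      using keys_mult[of "t - part Z t" f] unfolding keys_rest by auto
    have "deg c = deg a + deg b" "deg c = deg \<alpha>"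
      using ab(1) cE by (simp_all add: deg_def lookup_add E_def flip: sum.distrib)
    \<comment> \<open>A factor \<open>a\<close> involving \<open>A\<close> leaves \<open>b\<close>
      with degree below the minimum \<open>deg \<alpha>\<close>, which forces \<open>b\<close> into
      \<open>Q\<close>.\<close>
    moreover have "deg a > 0"
      using ab(2) by (auto simp: Z_def deg_def sum_pos2 intro!: Nat.gr0I)
    ultimately have "b \<in> Q"
      using min[OF ab(3)] by linarith
    then have "c \<in> Q"
      using Q ab(1) unfolding up_closed_def by (metis add.commute)
    then show False using cQ by simp
  qed
  moreover have "t * f = part Z t * part E f + part Z t * (f - part E f) + (t - part Z t) * f"
    by (simp add: algebra_simps)
  ultimately have "Poly_Mapping.lookup (t * f) c = Poly_Mapping.lookup (part Z t * part E f) c"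
    by (simp add: lookup_add in_keys_iff)
  then have "c \<in> Poly_Mapping.keys (t * f)"
    using c by (simp add: in_keys_iff)
  then show False
    using tf cQ by (auto simp: monomial_span_def)
qed

subsection \<open>Intersections of powers of irreducible monomial ideals\<close>

text \<open>The exponents of the \<open>s\<close>-th power of the ideal generated by the \<open>x\<^sub>i ^ u i\<close>, \<open>i \<in> A\<close>.\<close>

definition irr_exps :: "'n set \<Rightarrow> ('n \<Rightarrow> nat) \<Rightarrow> nat \<Rightarrow> ('n \<Rightarrow>\<^sub>0 nat) set" where
  "irr_exps A u s = {b. s \<le> (\<Sum>i\<in>A. Poly_Mapping.lookup b i div u i)}"

text \<open>The index set is a parameter because the arguments below drop one component at a time,
  as in \<open>J - {k}\<close>.\<close>

definition sym_exps :: "nat set \<Rightarrow> (nat \<Rightarrow> 'n set) \<Rightarrow> (nat \<Rightarrow> 'n \<Rightarrow> nat) \<Rightarrow> nat \<Rightarrow> ('n \<Rightarrow>\<^sub>0 nat) set"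
  where "sym_exps J A u s = (\<Inter>j\<in>J. irr_exps (A j) (u j) s)"

lemma lookup_Abs_finite [simp]:
  "Poly_Mapping.lookup (Abs_poly_mapping f) = (f :: 'n::finite \<Rightarrow> 'a::zero)"
  by (rule lookup_Abs_poly_mapping) simp

lemma irr_exps_1_iff:
  fixes b :: "'n::finite \<Rightarrow>\<^sub>0 nat"
  assumes "\<forall>i\<in>A. u i \<ge> 1"
  shows "b \<in> irr_exps A u 1 \<longleftrightarrow> (\<exists>i\<in>A. u i \<le> Poly_Mapping.lookup b i)"
proof -
  have "b \<in> irr_exps A u 1 \<longleftrightarrow> (\<Sum>i\<in>A. Poly_Mapping.lookup b i div u i) \<noteq> 0"
    unfolding irr_exps_def by (simp add: Suc_le_eq del: sum_eq_0_iff)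
  also have "\<dots> \<longleftrightarrow> (\<exists>i\<in>A. Poly_Mapping.lookup b i div u i \<noteq> 0)"
    by simp
  also have "\<dots> \<longleftrightarrow> (\<exists>i\<in>A. u i \<le> Poly_Mapping.lookup b i)"
    using assms by (intro bex_cong refl) (auto simp: div_eq_0_iff Suc_le_eq)
  finally show ?thesis .
qed

lemmas irr_exps_Suc_0_iff = irr_exps_1_iff[unfolded One_nat_def]

lemma up_closed_irr_exps: "up_closed (irr_exps A u s)"
  unfolding up_closed_def
proof (intro ballI allI)
  fix a c assume "a \<in> irr_exps A u s"
  moreover have "(\<Sum>i\<in>A. Poly_Mapping.lookup a i div u i) \<le> (\<Sum>i\<in>A. Poly_Mapping.lookup (a + c) i div u i)"
    by (intro sum_mono div_le_mono) (simp add: lookup_add)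
  ultimately show "a + c \<in> irr_exps A u s"
    by (simp add: irr_exps_def)
qed

lemma irr_exps_cong:
  assumes "a \<in> irr_exps A u s"
    and "\<And>i. i \<in> A \<Longrightarrow> Poly_Mapping.lookup a i = Poly_Mapping.lookup b i"
  shows "b \<in> irr_exps A u s"
proof -
  have "(\<Sum>i\<in>A. Poly_Mapping.lookup a i div u i) = (\<Sum>i\<in>A. Poly_Mapping.lookup b i div u i)"
    by (rule sum.cong) (use assms(2) in auto)
  then show ?thesis
    using assms(1) by (simp add: irr_exps_def)
qed

lemma up_closed_sym_exps: "up_closed (sym_exps J A u s)"
  using up_closed_irr_exps[of "A _" "u _" s, unfolded up_closed_def]
  by (simp add: up_closed_def sym_exps_def)

lemma div_add_le: "x div n + y div n \<le> (x + y) div (n::nat)"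
proof (cases "n = 0")
  case False
  have "(x div n + y div n) * n \<le> x + y"
    by (simp add: add_mult_distrib add_mono)
  then show ?thesis
    using False by (simp add: less_eq_div_iff_mult_less_eq)
qed simp

lemma irr_exps_add:
  assumes "a \<in> irr_exps A u s" "b \<in> irr_exps A u t"
  shows "a + b \<in> irr_exps A u (s + t)"
proof -
  have "s + t \<le> (\<Sum>i\<in>A. Poly_Mapping.lookup a i div u i + Poly_Mapping.lookup b i div u i)"
    using assms unfolding irr_exps_def by (simp add: sum.distrib)
  also have "\<dots> \<le> (\<Sum>i\<in>A. Poly_Mapping.lookup (a + b) i div u i)"
    by (intro sum_mono) (simp add: lookup_add div_add_le)
  finally show ?thesis by (simp add: irr_exps_def)
qed

text \<open>Floor division is superadditive, so each further factor from \<open>U\<close> raises the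
  sum of quotients over \<open>A\<close> by at least one.\<close>

lemma sum_power_subset_irr_exps:
  assumes "U \<subseteq> irr_exps A u 1"
  shows "sum_power U s \<subseteq> irr_exps A u s"
proof (induction s)
  case 0
  show ?case by (simp add: irr_exps_def)
next
  case (Suc s)
  then show ?case
    using assms irr_exps_add[of _ A u s _ 1] by fastforce
qed

lemma pure_power_ideal_eq:
  fixes u :: "'n::finite \<Rightarrow> nat"
  assumes "\<forall>i\<in>A. u i \<ge> 1"
  shows "(pure_power_ideal A u :: ('n, 'k::field) mpoly set) = monomial_span (irr_exps A u 1)"
proof -
  have "up_closure ((\<lambda>i. Poly_Mapping.single i (u i)) ` A) = irr_exps A u 1"
  proof -
    have "(\<forall>i'. Poly_Mapping.lookup (Poly_Mapping.single i (u i)) i' \<le> Poly_Mapping.lookup b i')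
        \<longleftrightarrow> u i \<le> Poly_Mapping.lookup b i" for b i
      by (auto simp: lookup_single when_def)
    then show ?thesis
      using irr_exps_1_iff[OF assms] by (auto simp: up_closure_iff)
  qed
  then show ?thesis
    unfolding pure_power_ideal_def using genideal_xpow[of "(\<lambda>i. Poly_Mapping.single i (u i)) ` A"]
    by (simp add: image_image)
qed

section \<open>Radicals and associated primes of the components\<close>

text \<open>With all weights 1 the irreducible ideal is the prime generated by the variables of
  \<open>A\<close>; this span stands for that prime throughout.\<close>

lemma variable_span_iff:
  fixes f :: "('n::finite, 'k::field) mpoly"
  shows "f \<in> monomial_span (irr_exps A (\<lambda>_. 1) 1) \<longleftrightarrow>
    (\<forall>a\<in>Poly_Mapping.keys f. \<exists>i\<in>A. Poly_Mapping.lookup a i \<noteq> 0)"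
proof -
  have "b \<in> irr_exps A (\<lambda>_. 1) 1 \<longleftrightarrow> (\<exists>i\<in>A. Poly_Mapping.lookup b i \<noteq> 0)" for b
    using irr_exps_1_iff[of A "\<lambda>_. 1" b] by (simp add: Suc_le_eq)
  then show ?thesis
    unfolding monomial_span_def by blast
qed

text \<open>A polynomial outside the span has a term free of \<open>A\<close>, and membership in
  \<open>irr_exps\<close> depends on the coordinates in \<open>A\<close> alone, so such a factor can
  be cancelled.\<close>

lemma variable_span_prime:
  fixes f g :: "('n::{finite,linorder}, 'k::field) mpoly"
  assumes "g * f \<in> monomial_span (irr_exps A (\<lambda>_. 1) 1)"
    and "g \<notin> monomial_span (irr_exps A (\<lambda>_. 1) 1)"
  shows "f \<in> monomial_span (irr_exps A (\<lambda>_. 1) 1)"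
proof -
  obtain e where "e \<in> Poly_Mapping.keys g" "\<And>i. i \<in> A \<Longrightarrow> Poly_Mapping.lookup e i = 0"
    using assms(2) unfolding variable_span_iff by blast
  from monomial_span_primary[OF up_closed_irr_exps irr_exps_cong this assms(1)]
  show ?thesis .
qed

text \<open>One inclusion is primality, the other a pigeonhole argument. It serves to turn the
  distinct radicals of the decomposition into distinct primes of variables.\<close>

lemma radical_pure_power_ideal:
  fixes u :: "'n::{finite,linorder} \<Rightarrow> nat"
  assumes u: "\<forall>i\<in>A. u i \<ge> 1"
  shows "(radical (pure_power_ideal A u) :: ('n, 'k::field) mpoly set) =
    monomial_span (irr_exps A (\<lambda>_. 1) 1)"
proof (intro equalityI subsetI)
  let ?V = "irr_exps A (\<lambda>_. 1) 1"
  let ?S = "monomial_span ?V :: ('n, 'k) mpoly set"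
  fix f :: "('n, 'k) mpoly"
  {
    assume "f \<in> radical (pure_power_ideal A u)"
    then obtain m where "f ^ m \<in> monomial_span (irr_exps A u 1)"
      unfolding radical_def pure_power_ideal_eq[OF u] by blast
    moreover have "irr_exps A u 1 \<subseteq> ?V"
    proof
      fix b assume "b \<in> irr_exps A u 1"
      then obtain i where "i \<in> A" "u i \<le> Poly_Mapping.lookup b i"
        using irr_exps_1_iff[OF u] by auto
      then show "b \<in> ?V"
        using u irr_exps_1_iff[of A "\<lambda>_. 1" b] by (meson order_refl order_trans)
    qed
    ultimately have "f ^ m \<in> ?S"
      by (auto simp: monomial_span_def)
    then show "f \<in> ?S"
    proof (induction m)
      case 0
      then show ?case
        unfolding variable_span_iff by simp
    next
      case (Suc m)
      show ?case
      proof (rule ccontr)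
        assume nf: "f \<notin> ?S"
        then have "f ^ m \<in> ?S"
          using variable_span_prime[of f "f ^ m" A] Suc.prems by simp
        then show False using Suc.IH nf by simp
      qed
    qed
  next
    assume f: "f \<in> ?S"
    \<comment> \<open>Pigeonhole: a monomial whose degree in the variables of \<open>A\<close> is
      above the sum of the \<open>u i\<close> must reach one of the bounds
      \<open>u i\<close>.\<close>
    define m where "m = Suc (\<Sum>i\<in>A. u i)"
    have "f ^ s \<in> monomial_span (irr_exps A (\<lambda>_. 1) s)" for s
    proof (induction s)
      case 0
      show ?case by (simp add: monomial_span_def irr_exps_def)
    next
      case (Suc s)
      then have "f ^ s * f \<in> monomial_span (irr_exps A (\<lambda>_. 1) (s + 1))"
        using f keys_mult[of "f ^ s" f] irr_exps_add[of _ A "\<lambda>_. 1" s _ 1]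
        unfolding monomial_span_def by fastforce
      then show ?case by (simp add: mult.commute)
    qed
    moreover have "irr_exps A (\<lambda>_. 1) m \<subseteq> irr_exps A u 1"
    proof
      fix b assume b: "b \<in> irr_exps A (\<lambda>_. 1) m"
      have "\<exists>i\<in>A. u i \<le> Poly_Mapping.lookup b i"
      proof (rule ccontr)
        assume "\<not> ?thesis"
        then have "(\<Sum>i\<in>A. Poly_Mapping.lookup b i) \<le> (\<Sum>i\<in>A. u i)"
          by (intro sum_mono) (simp add: not_le less_imp_le)
        then show False using b by (simp add: irr_exps_def m_def)
      qed
      then show "b \<in> irr_exps A u 1"
        using u by (simp add: irr_exps_1_iff irr_exps_Suc_0_iff)
    qed
    ultimately have "f ^ m \<in> pure_power_ideal A u"
      unfolding pure_power_ideal_eq[OF u] monomial_span_def by blast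
    moreover have "m \<ge> 1" by (simp add: m_def)
    ultimately show "f \<in> radical (pure_power_ideal A u)"
      unfolding radical_def by blast
  }
qed

lemma colon_variable:
  fixes f :: "('n::{finite,linorder}, 'k::field) mpoly"
  assumes u: "\<forall>i\<in>A. u i \<ge> 1" and i: "i \<notin> A"
    and f: "xpow (Poly_Mapping.single i 1) * f \<in> monomial_span (irr_exps A u 1)"
  shows "f \<in> monomial_span (irr_exps A u 1)"
proof -
  have 1: "Poly_Mapping.single i 1 \<in> Poly_Mapping.keys (xpow (Poly_Mapping.single i 1) :: ('n, 'k) mpoly)"
    by (simp add: xpow_def)
  have 2: "Poly_Mapping.lookup (Poly_Mapping.single i (1::nat)) i' = 0" if "i' \<in> A" for i'
    using that i by (auto simp: lookup_single when_def)
  show ?thesis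
    by (rule monomial_span_primary[OF up_closed_irr_exps irr_exps_cong 1 2 f])
qed

text \<open>Raising \<open>b\<close> to \<open>u - 1\<close> on \<open>A\<close> keeps it outside the \<open>k\<close>-th component, and then only the variables of
  \<open>A\<close> push it inside.\<close>

lemma associated_primeI:
  fixes A :: "nat \<Rightarrow> 'n::{finite,linorder} set"
  assumes u: "\<forall>j\<in>J. \<forall>i\<in>A j. u j i \<ge> 1" and k: "k \<in> J"
    and b: "b \<notin> irr_exps (A k) (u k) 1" "b \<in> sym_exps (J - {k}) A u 1"
  shows "(monomial_span (irr_exps (A k) (\<lambda>_. 1) 1) :: ('n, 'k::field) mpoly set)
    \<in> associated_primes (monomial_span (sym_exps J A u 1))" (is "?P \<in> associated_primes ?I")
proof -
  define V where "V = irr_exps (A k) (\<lambda>_. 1) 1"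
  have P: "primeideal ?P whole_ring"
    unfolding primeideal_whole_ring_iff
  proof (intro conjI allI impI)
    show "ideal ?P whole_ring"
      by (rule ideal_monomial_span[OF up_closed_irr_exps])
    show "1 \<notin> ?P"
      unfolding variable_span_iff by simp
    fix f g :: "('n, 'k) mpoly" assume fg: "f * g \<in> ?P"
    show "f \<in> ?P \<or> g \<in> ?P"
      using variable_span_prime[OF fg] by blast
  qed
  define b' where "b' = Abs_poly_mapping (\<lambda>i. if i \<in> A k then u k i - 1 else Poly_Mapping.lookup b i)"
  have lb': "Poly_Mapping.lookup b' i = (if i \<in> A k then u k i - 1 else Poly_Mapping.lookup b i)" for i
    by (simp add: b'_def)
  \<comment> \<open>Lying outside the \<open>k\<close>-th component means \<open>b i < u k i\<close>
    on \<open>A k\<close>, so the change to \<open>u k i - 1\<close> never lowers an exponent and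
    \<open>b'\<close> stays in the other components.\<close>
  have "Poly_Mapping.lookup b i \<le> Poly_Mapping.lookup b' i" for i
    using b(1) u k by (force simp: lb' irr_exps_1_iff irr_exps_Suc_0_iff)
  then have b': "b' \<in> sym_exps (J - {k}) A u 1"
    using up_closedD[OF up_closed_sym_exps b(2)] by blast
  have *: "a + b' \<in> sym_exps J A u 1 \<longleftrightarrow> a \<in> V" for a
  proof -
    have "a + b' \<in> sym_exps (J - {k}) A u 1"
      using b' up_closed_sym_exps unfolding up_closed_def by (metis add.commute)
    then have "a + b' \<in> sym_exps J A u 1 \<longleftrightarrow> a + b' \<in> irr_exps (A k) (u k) 1"
      using k unfolding sym_exps_def by blast
    also have "\<dots> \<longleftrightarrow> (\<exists>i\<in>A k. u k i \<le> Poly_Mapping.lookup a i + (u k i - 1))"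
      using u k by (simp add: irr_exps_1_iff irr_exps_Suc_0_iff lookup_add lb')
    also have "\<dots> \<longleftrightarrow> (\<exists>i\<in>A k. 1 \<le> Poly_Mapping.lookup a i)"
      using u k by (intro bex_cong refl) (force simp: Suc_le_eq)
    also have "\<dots> \<longleftrightarrow> a \<in> V"
      by (simp add: V_def irr_exps_1_iff irr_exps_Suc_0_iff)
    finally show ?thesis .
  qed
  have keys_shift: "Poly_Mapping.keys (f * xpow b') = (\<lambda>a. a + b') ` Poly_Mapping.keys f"
    for f :: "('n, 'k) mpoly"
  proof (intro equalityI)
    show "Poly_Mapping.keys (f * xpow b') \<subseteq> (\<lambda>a. a + b') ` Poly_Mapping.keys f"
      using keys_mult[of f "xpow b'"] by (auto simp: xpow_def)
    have "Poly_Mapping.lookup (f * xpow b') (a + b') = Poly_Mapping.lookup f a" for a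
    proof -
      have "(Poly_Mapping.lookup (xpow b' :: ('n, 'k) mpoly) q when a + b' = l + q) =
          ((1 when a = l) when b' = q)" for l q
        by (auto simp: xpow_def lookup_single when_def)
      then show ?thesis
        by (simp add: lookup_mult mult_when)
    qed
    then show "(\<lambda>a. a + b') ` Poly_Mapping.keys f \<subseteq> Poly_Mapping.keys (f * xpow b')"
      by (auto simp: in_keys_iff)
  qed
  have "?P = {f. f * xpow b' \<in> ?I}"
    unfolding monomial_span_def using * by (auto simp: keys_shift V_def)
  then show ?thesis
    using P unfolding associated_primes_def by blast
qed

text \<open>The polynomial \<open>f\<close> defining the colon ideal is outside \<open>I\<close>,
  hence outside some component \<open>j\<close>, and modulo that component every variable outside
  \<open>A j\<close> can be cancelled. With \<open>prime_contains_variable\<close> this shows that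
  monomials free of \<open>A j\<close> are outside \<open>P\<close>, without determining
  \<open>P\<close>.\<close>

lemma associated_prime_variables:
  fixes A :: "nat \<Rightarrow> 'n::{finite,linorder} set" and P :: "('n, 'k::field) mpoly set"
  assumes u: "\<forall>j\<in>J. \<forall>i\<in>A j. u j i \<ge> 1"
    and P: "P \<in> associated_primes (monomial_span (sym_exps J A u 1))"
  shows "\<exists>j\<in>J. \<forall>i. xpow (Poly_Mapping.single i 1) \<in> P \<longrightarrow> i \<in> A j"
proof -
  obtain f where f: "P = {g. g * f \<in> monomial_span (sym_exps J A u 1)}" and "primeideal P whole_ring"
    using P by (auto simp: associated_primes_def)
  then have "1 * f \<notin> monomial_span (sym_exps J A u 1)"
    unfolding primeideal_whole_ring_iff by blast
  then obtain j where j: "j \<in> J" "f \<notin> monomial_span (irr_exps (A j) (u j) 1)"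
    by (auto simp: monomial_span_def sym_exps_def)
  have "i \<in> A j" if "xpow (Poly_Mapping.single i 1) \<in> P" for i
  proof (rule ccontr)
    assume i: "i \<notin> A j"
    have "xpow (Poly_Mapping.single i 1) * f \<in> monomial_span (irr_exps (A j) (u j) 1)"
      using that j(1) unfolding f monomial_span_def sym_exps_def by blast
    then show False
      using colon_variable[OF bspec[OF u j(1)] i] j by blast
  qed
  then show ?thesis using j(1) by blast
qed

subsection \<open>Symbolic powers and conflicting weights\<close>

definition incomparable :: "nat set \<Rightarrow> (nat \<Rightarrow> 'n set) \<Rightarrow> bool" where
  "incomparable J A \<longleftrightarrow> (\<forall>j\<in>J. \<forall>k\<in>J. j \<noteq> k \<longrightarrow> \<not> A j \<subseteq> A k)"

text \<open>Every other \<open>A j\<close> has a variable outside \<open>A k\<close>; giving each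
  variable outside \<open>A k\<close> the exponent summed over \<open>J\<close> reaches all bounds
  at once.\<close>

lemma incomparable_witness:
  fixes A :: "nat \<Rightarrow> 'n::finite set"
  assumes "finite J" "incomparable J A" "k \<in> J" and u: "\<forall>j\<in>J. \<forall>i\<in>A j. u j i \<ge> 1"
  shows "\<exists>b. (\<forall>i\<in>A k. Poly_Mapping.lookup b i = 0) \<and> b \<in> sym_exps (J - {k}) A u 1"
proof (intro exI conjI)
  let ?b = "Abs_poly_mapping (\<lambda>i. if i \<in> A k then 0 else \<Sum>j\<in>J. u j i)"
  show "\<forall>i\<in>A k. Poly_Mapping.lookup ?b i = 0"
    by simp
  show "?b \<in> sym_exps (J - {k}) A u 1"
    unfolding sym_exps_def
  proof
    fix j assume j: "j \<in> J - {k}"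
    then obtain i where i: "i \<in> A j" "i \<notin> A k"
      using assms(2,3) unfolding incomparable_def by blast
    have "u j i \<le> (\<Sum>j\<in>J. u j i)"
      using assms(1) j by (intro member_le_sum) auto
    then show "?b \<in> irr_exps (A j) (u j) 1"
      using irr_exps_1_iff[of "A j" "u j" ?b] u j i by auto
  qed
qed

text \<open>Once \<open>t\<close> lies in all components but the \<open>j\<close>-th, multiplication by \<open>s\<close> copies of \<open>t\<close> splits a
  monomial of the \<open>s\<close>-th power of that component into \<open>s\<close> monomials of the intersection.\<close>

lemma sum_power_shift:
  fixes A :: "nat \<Rightarrow> 'n::finite set"
  assumes u: "\<forall>j\<in>J. \<forall>i\<in>A j. u j i \<ge> 1" and j: "j \<in> J"
    and t: "t \<in> sym_exps (J - {j}) A u 1" and c: "c \<in> irr_exps (A j) (u j) s"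
  shows "c + (\<Sum>_<s. t) \<in> sum_power (sym_exps J A u 1) s"
  using c
proof (induction s arbitrary: c)
  case 0
  then show ?case by simp
next
  case (Suc s)
  have "(\<Sum>i\<in>A j. Poly_Mapping.lookup c i div u j i) \<noteq> 0"
    using Suc.prems by (simp add: irr_exps_def del: sum_eq_0_iff)
  then obtain i where i: "i \<in> A j" "u j i \<le> Poly_Mapping.lookup c i"
    by (auto simp: div_eq_0_iff)
  define g where "g = Poly_Mapping.single i (u j i)"
  obtain c' where c': "c = g + c'"
    by (rule exponent_le_imp_add[of g c]) (use i(2) in \<open>auto simp: g_def lookup_single when_def\<close>)
  have upos: "u j i > 0"
    using u j i(1) by (force simp: Suc_le_eq)
  \<comment> \<open>Removing one full block \<open>u j i\<close> from coordinate \<open>i\<close>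
    lowers its quotient by exactly one and leaves the others unchanged.\<close>
  have "(\<Sum>i'\<in>A j. Poly_Mapping.lookup c i' div u j i') =
      (\<Sum>i'\<in>A j. (if i' = i then 1 else 0) + Poly_Mapping.lookup c' i' div u j i')"
    using upos by (intro sum.cong) (auto simp: c' g_def lookup_add lookup_single when_def)
  also have "\<dots> = 1 + (\<Sum>i'\<in>A j. Poly_Mapping.lookup c' i' div u j i')"
    using i(1) by (simp add: sum.distrib)
  finally have "c' \<in> irr_exps (A j) (u j) s"
    using Suc.prems by (simp add: irr_exps_def)
  then have "c' + (\<Sum>_<s. t) \<in> sum_power (sym_exps J A u 1) s"
    by (rule Suc.IH)
  moreover have "g + t \<in> sym_exps J A u 1"
    unfolding sym_exps_def
  proof
    fix k assume k: "k \<in> J"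
    show "g + t \<in> irr_exps (A k) (u k) 1"
    proof (cases "k = j")
      case True
      show ?thesis
      proof -
        have "u j i \<le> Poly_Mapping.lookup (g + t) i"
          by (simp add: g_def lookup_add)
        then show ?thesis
          unfolding True using irr_exps_1_iff[OF bspec[OF u j]] i(1) by blast
      qed
    next
      case False
      then have "t \<in> irr_exps (A k) (u k) 1"
        using t k by (auto simp: sym_exps_def)
      then show ?thesis
        using up_closed_irr_exps unfolding up_closed_def by (metis add.commute)
    qed
  qed
  moreover have "c + (\<Sum>_<Suc s. t) = (c' + (\<Sum>_<s. t)) + (g + t)"
    by (simp add: c' ac_simps)
  ultimately show ?case
    unfolding sum_power.simps by blast
qed

text \<open>At the prime of \<open>A k\<close> the multiplier \<open>t\<close> has a term free of
  \<open>A k\<close> and cancels modulo the \<open>s\<close>-th power of that component; this gives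
  one inclusion. Conversely, any associated \<open>P\<close> has its variables in one
  \<open>A j\<close>, so the \<open>s\<close>-th power of the monomial from
  \<open>incomparable_witness\<close> is a multiplier outside \<open>P\<close> that works for every
  \<open>f\<close>.\<close>

lemma symbolic_power_eq:
  fixes A :: "nat \<Rightarrow> 'n::{finite,linorder} set"
  assumes J: "finite J" "incomparable J A" and u: "\<forall>j\<in>J. \<forall>i\<in>A j. u j i \<ge> 1"
  shows "symbolic_power (monomial_span (sym_exps J A u 1) :: ('n, 'k::field) mpoly set) s =
    monomial_span (sym_exps J A u s)" (is "symbolic_power ?I s = _")
proof -
  define U where "U = sym_exps J A u 1"
  have upU: "up_closed U"
    unfolding U_def by (rule up_closed_sym_exps)
  have pow: "ideal_power ?I s = monomial_span (sum_power U s)"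
    unfolding U_def[symmetric] by (rule ideal_power_monomial_span[OF upU])
  have ipow: "ideal (ideal_power ?I s) whole_ring"
    unfolding pow by (intro ideal_monomial_span up_closed_sum_power upU)
  have contr: "contracted_localization P (ideal_power ?I s) =
      {f. \<exists>t. t \<notin> P \<and> t * f \<in> monomial_span (sum_power U s)}" if "P \<in> associated_primes ?I" for P
    using contracted_localization_eq[OF _ ipow] that unfolding pow associated_primes_def by blast
  show ?thesis
  proof (intro equalityI subsetI)
    fix f assume f: "f \<in> symbolic_power ?I s"
    have "f \<in> monomial_span (irr_exps (A k) (u k) s)" if k: "k \<in> J" for k
    proof -
      let ?P = "monomial_span (irr_exps (A k) (\<lambda>_. 1) 1) :: ('n, 'k) mpoly set"
      have P: "?P \<in> associated_primes ?I"
      proof -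
        obtain b where b: "\<forall>i\<in>A k. Poly_Mapping.lookup b i = 0" "b \<in> sym_exps (J - {k}) A u 1"
          using incomparable_witness[OF J k u] by blast
        have "b \<notin> irr_exps (A k) (u k) 1"
          using b(1) by (simp add: irr_exps_def)
        from associated_primeI[OF u k this b(2)] show ?thesis .
      qed
      then obtain t where t: "t \<notin> ?P" "t * f \<in> monomial_span (sum_power U s)"
        using f contr[OF P] unfolding symbolic_power_def by blast
      obtain e where e: "e \<in> Poly_Mapping.keys t" "\<And>i. i \<in> A k \<Longrightarrow> Poly_Mapping.lookup e i = 0"
        using t(1) unfolding variable_span_iff by blast
      have "sum_power U s \<subseteq> irr_exps (A k) (u k) s"
        by (rule sum_power_subset_irr_exps) (use k in \<open>auto simp: U_def sym_exps_def\<close>)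
      then have "t * f \<in> monomial_span (irr_exps (A k) (u k) s)"
        using t(2) by (auto simp: monomial_span_def)
      from monomial_span_primary[OF up_closed_irr_exps irr_exps_cong e this]
      show ?thesis .
    qed
    then show "f \<in> monomial_span (sym_exps J A u s)"
      by (auto simp: monomial_span_def sym_exps_def)
  next
    fix f :: "('n, 'k) mpoly" assume f: "f \<in> monomial_span (sym_exps J A u s)"
    have "\<exists>t. t \<notin> P \<and> t * f \<in> monomial_span (sum_power U s)" if P: "P \<in> associated_primes ?I" for P
    proof -
      have prime: "primeideal P whole_ring"
        using P by (simp add: associated_primes_def)
      obtain j where j: "j \<in> J" "\<And>i. xpow (Poly_Mapping.single i 1) \<in> P \<Longrightarrow> i \<in> A j"
        using associated_prime_variables[OF u P] by blast
      obtain t where t: "\<forall>i\<in>A j. Poly_Mapping.lookup t i = 0" "t \<in> sym_exps (J - {j}) A u 1"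
        using incomparable_witness[OF J j(1) u] by blast
      note shift = sum_power_shift[OF u j(1) t(2)]
      let ?T = "\<Sum>_<s. t"
      have "xpow ?T \<notin> P"
      proof
        assume "xpow ?T \<in> P"
        then obtain i where "Poly_Mapping.lookup ?T i > 0" "i \<in> A j"
          using prime_contains_variable[OF prime] j(2) by blast
        then show False using t(1) by (simp add: lookup_sum)
      qed
      moreover have "xpow ?T * f \<in> monomial_span (sum_power U s)"
        unfolding monomial_span_def
      proof clarify
        fix b assume "b \<in> Poly_Mapping.keys (xpow ?T * f)"
        then obtain c where "b = c + ?T" "c \<in> Poly_Mapping.keys f"
          using keys_mult[of "xpow ?T" f] by (auto simp: xpow_def add.commute)
        moreover from this have "c \<in> irr_exps (A j) (u j) s"
          using f j(1) by (auto simp: monomial_span_def sym_exps_def)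
        ultimately show "b \<in> sum_power U s"
          using shift by (simp add: U_def)
      qed
      ultimately show ?thesis by blast
    qed
    then show "f \<in> symbolic_power ?I s"
      unfolding symbolic_power_def using contr by blast
  qed
qed

lemma simis_ideal_iff:
  fixes A :: "nat \<Rightarrow> 'n::{finite,linorder} set"
  assumes "finite J" "incomparable J A" "\<forall>j\<in>J. \<forall>i\<in>A j. u j i \<ge> 1"
  shows "simis_ideal (monomial_span (sym_exps J A u 1) :: ('n, 'k::field) mpoly set) \<longleftrightarrow>
    (\<forall>s\<ge>1. sym_exps J A u s = sum_power (sym_exps J A u 1) s)"
  unfolding simis_ideal_def symbolic_power_eq[OF assms]
    ideal_power_monomial_span[OF up_closed_sym_exps]
  by (simp add: monomial_ideal_monomial_span up_closed_sym_exps)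

text \<open>Write \<open>c = u k i\<close>, \<open>d = u l i\<close> and choose \<open>q\<close> in \<open>A l\<close> but not in \<open>A k\<close>. Up to a monomial in
  the variables outside \<open>A k \<union> A l\<close>, which takes care of the other components, the witness is
  \<open>x\<^sub>i ^ max (2 c) d * x\<^sub>q ^ u l q\<close>. One of two factors from the ideal would have to be divisible by
  \<open>x\<^sub>i ^ d\<close> and the other by \<open>x\<^sub>i ^ c\<close>, but \<open>c + d > max (2 c) d\<close>.\<close>

lemma conflict_symbolic_square:
  fixes A :: "nat \<Rightarrow> 'n::finite set"
  assumes J: "finite J" "incomparable J A" and u: "\<forall>j\<in>J. \<forall>i\<in>A j. u j i \<ge> 1"
    and kl: "k \<in> J" "l \<in> J" "k \<noteq> l" and i: "i \<in> A k" "i \<in> A l" "u k i < u l i"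
    and others: "\<forall>j\<in>J - {k, l}. \<not> A j \<subseteq> A k \<union> A l"
  shows "sym_exps J A u 2 \<noteq> sum_power (sym_exps J A u 1) 2"
proof -
  have "\<not> A l \<subseteq> A k"
    using J(2) kl by (simp add: incomparable_def)
  then obtain q where q: "q \<in> A l" "q \<notin> A k"
    by auto
  \<comment> \<open>Outside \<open>A k \<union> A l\<close> the exponent at \<open>i'\<close> is at
    least \<open>2 * u j i'\<close> for every \<open>j\<close>, so one such variable puts
    \<open>b\<close> into the square of each remaining component. Inside, only \<open>i\<close> and
    \<open>q\<close> carry positive exponents.\<close>
  define b where "b = Abs_poly_mapping (\<lambda>i'. if i' = i then max (2 * u k i) (u l i)
    else if i' = q then u l q else if i' \<in> A k \<union> A l then 0 else \<Sum>j\<in>J. 2 * u j i')"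
  have lb: "Poly_Mapping.lookup b i' = (if i' = i then max (2 * u k i) (u l i)
    else if i' = q then u l q else if i' \<in> A k \<union> A l then 0 else \<Sum>j\<in>J. 2 * u j i')" for i'
    by (simp add: b_def)
  have qi: "q \<noteq> i" using q i by auto
  have pos: "u k i > 0" "u l i > 0" "u l q > 0"
    using u kl i q by (force simp: Suc_le_eq)+
  have sum_ge: "(\<Sum>i'\<in>D. Poly_Mapping.lookup b i' div v i') \<le> (\<Sum>i'\<in>A j. Poly_Mapping.lookup b i' div v i')"
    if "D \<subseteq> A j" for D v j
    using that by (intro sum_mono2) auto
  have "b \<in> irr_exps (A j) (u j) 2" if j: "j \<in> J" for j
  proof -
    consider "j = k" | "j = l" | "j \<in> J - {k, l}" using j by blast
    then have "2 \<le> (\<Sum>i'\<in>A j. Poly_Mapping.lookup b i' div u j i')"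
    proof cases
      case 1
      have "2 * u k i div u k i \<le> Poly_Mapping.lookup b i div u k i"
        by (intro div_le_mono) (simp add: lb)
      then show ?thesis
        using sum_ge[of "{i}" k "u k"] pos i(1) unfolding 1 by simp
    next
      case 2
      have "u l i div u l i \<le> Poly_Mapping.lookup b i div u l i"
        by (intro div_le_mono) (simp add: lb)
      then show ?thesis
        using sum_ge[of "{i, q}" l "u l"] pos i(2) q(1) qi unfolding 2 by (simp add: lb)
    next
      case 3
      then obtain p where p: "p \<in> A j" "p \<notin> A k \<union> A l"
        using others by blast
      then have "2 * u j p \<le> Poly_Mapping.lookup b p"
        using i q member_le_sum[of j J "\<lambda>j. 2 * u j p"] J(1) j by (auto simp: lb)
      then have "2 * u j p div u j p \<le> Poly_Mapping.lookup b p div u j p"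
        by (intro div_le_mono)
      moreover have "u j p > 0"
        using u j p by (force simp: Suc_le_eq)
      ultimately show ?thesis
        using sum_ge[of "{p}" j "u j"] p(1) by simp
    qed
    then show ?thesis by (simp add: irr_exps_def)
  qed
  then have "b \<in> sym_exps J A u 2" by (simp add: sym_exps_def)
  moreover have "b \<notin> sum_power (sym_exps J A u 1) 2"
  proof
    assume "b \<in> sum_power (sym_exps J A u 1) 2"
    then obtain x y h where xyh: "b = x + y + h" "y \<in> sym_exps J A u 1" "h \<in> sym_exps J A u 1"
      unfolding numeral_2_eq_2 sum_power.simps by blast
    \<comment> \<open>The third summand \<open>x\<close> comes from the start value
      \<open>UNIV\<close> of \<open>sum_power\<close>; absorbing it into \<open>y\<close> leaves two
      factors.\<close>
    define g where "g = x + y"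
    have gh: "b = g + h"
      by (simp add: g_def xyh(1))
    have g: "g \<in> sym_exps J A u 1"
      unfolding g_def
      by (rule up_closedD[OF up_closed_sym_exps xyh(2)]) (simp add: lookup_add)
    \<comment> \<open>On \<open>A k\<close> a divisor of \<open>b\<close> can only use
      \<open>i\<close>, since \<open>q\<close> lies outside \<open>A k\<close>; on
      \<open>A l\<close> it may use \<open>i\<close> or \<open>q\<close>.\<close>
    have part: "u k i \<le> Poly_Mapping.lookup a i \<and>
        (u l i \<le> Poly_Mapping.lookup a i \<or> u l q \<le> Poly_Mapping.lookup a q)"
      if a: "a \<in> sym_exps J A u 1" and ab: "\<And>i'. Poly_Mapping.lookup a i' \<le> Poly_Mapping.lookup b i'" for a
    proof
      obtain i1 where i1: "i1 \<in> A k" "u k i1 \<le> Poly_Mapping.lookup a i1"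
        using a kl(1) u irr_exps_1_iff[of "A k" "u k" a] by (auto simp: sym_exps_def)
      moreover have "u k i1 > 0" using u kl i1 by (force simp: Suc_le_eq)
      ultimately have "i1 = i"
        using ab[of i1] q by (auto simp: lb split: if_splits)
      then show "u k i \<le> Poly_Mapping.lookup a i" using i1 by simp
      obtain i2 where i2: "i2 \<in> A l" "u l i2 \<le> Poly_Mapping.lookup a i2"
        using a kl(2) u irr_exps_1_iff[of "A l" "u l" a] by (auto simp: sym_exps_def)
      moreover have "u l i2 > 0" using u kl i2 by (force simp: Suc_le_eq)
      ultimately have "i2 = i \<or> i2 = q"
        using ab[of i2] by (auto simp: lb split: if_splits)
      then show "u l i \<le> Poly_Mapping.lookup a i \<or> u l q \<le> Poly_Mapping.lookup a q"
        using i2 by auto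
    qed
    have "Poly_Mapping.lookup g i + Poly_Mapping.lookup h i = max (2 * u k i) (u l i)"
      "Poly_Mapping.lookup g q + Poly_Mapping.lookup h q = u l q"
      using lb[of i] lb[of q] qi by (simp_all add: gh lookup_add)
    moreover have "u k i \<le> Poly_Mapping.lookup g i \<and>
        (u l i \<le> Poly_Mapping.lookup g i \<or> u l q \<le> Poly_Mapping.lookup g q)"
      by (rule part[OF g]) (simp add: gh lookup_add)
    moreover have "u k i \<le> Poly_Mapping.lookup h i \<and>
        (u l i \<le> Poly_Mapping.lookup h i \<or> u l q \<le> Poly_Mapping.lookup h q)"
      by (rule part[OF xyh(3)]) (simp add: gh lookup_add)
    \<comment> \<open>The exponent \<open>u l q\<close> at \<open>q\<close> serves only one of
      \<open>g\<close> and \<open>h\<close>; the other needs \<open>u l i\<close> at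
      \<open>i\<close>. The sum \<open>u k i + u l i\<close> is too large because
      \<open>0 < u k i < u l i\<close>.\<close>
    ultimately show False
      using pos i(3) by linarith
  qed
  ultimately show ?thesis by blast
qed

subsection \<open>Standard linear weightings\<close>

text \<open>For positive weights this is the right adjoint of \<open>weight_exponent w\<close>:
  \<open>weight_exponent w a\<close> is below \<open>b\<close> iff \<open>a\<close> is below
  \<open>floor_exponent w b\<close>.\<close>

definition floor_exponent :: "('n \<Rightarrow> nat) \<Rightarrow> ('n \<Rightarrow>\<^sub>0 nat) \<Rightarrow> ('n \<Rightarrow>\<^sub>0 nat)" where
  "floor_exponent w b = Abs_poly_mapping (\<lambda>i. Poly_Mapping.lookup b i div w i)"

lemma lookup_floor_exponent [simp]:
  "Poly_Mapping.lookup (floor_exponent w b) i = Poly_Mapping.lookup b i div w (i :: 'n::finite)"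
  by (simp add: floor_exponent_def)

lemma lookup_weight_exponent [simp]:
  "Poly_Mapping.lookup (weight_exponent w a) i = w i * Poly_Mapping.lookup a i"
  by (auto simp: weight_exponent_def lookup_mapp when_def in_keys_iff)

lemma floor_weight_exponent:
  "standard_weighting w \<Longrightarrow> floor_exponent w (weight_exponent w a) = (a :: 'n::finite \<Rightarrow>\<^sub>0 nat)"
  by (rule poly_mapping_eqI) (simp add: standard_weighting_def)

lemma weight_floor_exponent_le:
  "Poly_Mapping.lookup (weight_exponent w (floor_exponent w b)) i \<le> Poly_Mapping.lookup b (i :: 'n::finite)"
  by simp

text \<open>This is the adjunction read on up-closed sets; it turns the passage from
  \<open>J\<close> to \<open>J_w\<close> into a preimage.\<close>

lemma up_closure_weight_exponent:
  fixes V :: "('n::finite \<Rightarrow>\<^sub>0 nat) set"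
  assumes "standard_weighting w" "up_closed V"
  shows "up_closure (weight_exponent w ` V) = {b. floor_exponent w b \<in> V}"
proof (intro equalityI subsetI)
  fix b assume "b \<in> up_closure (weight_exponent w ` V)"
  then obtain a where "a \<in> V" and a: "\<And>i. w i * Poly_Mapping.lookup a i \<le> Poly_Mapping.lookup b i"
    by (auto simp: up_closure_iff)
  moreover have "Poly_Mapping.lookup a i \<le> Poly_Mapping.lookup (floor_exponent w b) i" for i
    using a[of i] assms(1)
    by (simp add: standard_weighting_def less_eq_div_iff_mult_less_eq mult.commute)
  ultimately show "b \<in> {b. floor_exponent w b \<in> V}"
    using up_closedD[OF assms(2)] by blast
next
  fix b assume "b \<in> {b. floor_exponent w b \<in> V}"
  then show "b \<in> up_closure (weight_exponent w ` V)"
    unfolding up_closure_iff using weight_floor_exponent_le[of w b] by blast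
qed

lemma weighted_ideal_monomial_span:
  fixes V :: "('n::finite \<Rightarrow>\<^sub>0 nat) set"
  assumes "standard_weighting w" "up_closed V"
  shows "weighted_ideal w (monomial_span V :: ('n, 'k::field) mpoly set) =
    monomial_span {b. floor_exponent w b \<in> V}"
proof -
  have "{xpow (weight_exponent w a) | a. (xpow a :: ('n, 'k) mpoly) \<in> monomial_span V} =
      (xpow ` weight_exponent w ` V :: ('n, 'k) mpoly set)"
    by auto
  then show ?thesis
    unfolding weighted_ideal_def up_closure_weight_exponent[OF assms, symmetric]
    by (simp add: genideal_xpow)
qed

text \<open>With common weights the quotient \<open>b i div w i\<close> is both the contribution of
  \<open>i\<close> to every component containing it and an exponent of
  \<open>floor_exponent w b\<close>.\<close>

lemma sym_exps_weighted:
  fixes A :: "nat \<Rightarrow> 'n::finite set"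
  assumes "\<forall>j\<in>J. \<forall>i\<in>A j. u j i = w i"
  shows "sym_exps J A u s = {b. floor_exponent w b \<in> sym_exps J A (\<lambda>_ _. 1) s}"
proof -
  have "(\<Sum>i\<in>A j. Poly_Mapping.lookup b i div u j i) = (\<Sum>i\<in>A j. Poly_Mapping.lookup b i div w i)"
    if "j \<in> J" for j and b :: "'n \<Rightarrow>\<^sub>0 nat"
    using that assms by (intro sum.cong) auto
  then show ?thesis
    by (auto simp: sym_exps_def irr_exps_def)
qed

text \<open>Superadditivity of floors gives one inclusion. For the other, weighting is additive, so
  a splitting of \<open>floor_exponent w b\<close> can be weighted, and \<open>b\<close> dominates
  the weighted floor.\<close>

lemma sum_power_weighted:
  fixes V :: "('n::finite \<Rightarrow>\<^sub>0 nat) set"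
  assumes w: "standard_weighting w" and V: "up_closed V"
  defines "U \<equiv> {b. floor_exponent w b \<in> V}"
  shows "sum_power U s = {b. floor_exponent w b \<in> sum_power V s}"
proof (intro equalityI subsetI)
  fix b assume "b \<in> sum_power U s"
  then have "floor_exponent w b \<in> sum_power V s"
  proof (induction s arbitrary: b)
    case (Suc s)
    then obtain c d where cd: "b = c + d" "floor_exponent w c \<in> sum_power V s" "floor_exponent w d \<in> V"
      by (auto simp: U_def)
    have "floor_exponent w c + floor_exponent w d \<in> sum_power V (Suc s)"
      using cd(2,3) by auto
    moreover have "Poly_Mapping.lookup (floor_exponent w c + floor_exponent w d) i
        \<le> Poly_Mapping.lookup (floor_exponent w b) i" for i
      unfolding cd(1) lookup_add lookup_floor_exponent by (rule div_add_le)
    ultimately show ?case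
      by (rule up_closedD[OF up_closed_sum_power[OF V]])
  qed simp
  then show "b \<in> {b. floor_exponent w b \<in> sum_power V s}" by simp
next
  have upU: "up_closed U"
    unfolding U_def up_closure_weight_exponent[OF w V, symmetric] by (rule up_closed_up_closure)
  have weight: "weight_exponent w a \<in> sum_power U s" if "a \<in> sum_power V s" for a
    using that
  proof (induction s arbitrary: a)
    case (Suc s)
    then obtain c d where cd: "a = c + d" "c \<in> sum_power V s" "d \<in> V"
      by auto
    have "weight_exponent w a = weight_exponent w c + weight_exponent w d"
      by (rule poly_mapping_eqI) (simp add: cd(1) lookup_add add_mult_distrib2)
    moreover have "weight_exponent w d \<in> U"
      using cd(3) w by (simp add: U_def floor_weight_exponent)
    ultimately show ?case
      using Suc.IH[OF cd(2)] by auto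
  qed simp
  fix b assume "b \<in> {b. floor_exponent w b \<in> sum_power V s}"
  then have "weight_exponent w (floor_exponent w b) \<in> sum_power U s"
    using weight by blast
  then show "b \<in> sum_power U s"
    using up_closedD[OF up_closed_sum_power[OF upU]] weight_floor_exponent_le by blast
qed

lemma simis_ideal_weighted:
  fixes A :: "nat \<Rightarrow> 'n::{finite,linorder} set"
  assumes J: "finite J" "incomparable J A" and w: "standard_weighting w"
    and u: "\<forall>j\<in>J. \<forall>i\<in>A j. u j i = w i"
  shows "simis_ideal (monomial_span (sym_exps J A u 1) :: ('n, 'k::field) mpoly set) \<longleftrightarrow>
    simis_ideal (monomial_span (sym_exps J A (\<lambda>_ _. 1) 1) :: ('n, 'k) mpoly set)"
proof -
  have u1: "\<forall>j\<in>J. \<forall>i\<in>A j. u j i \<ge> 1" "\<forall>j\<in>J. \<forall>i\<in>A j. (1::nat) \<ge> 1"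
    using u w by (auto simp: standard_weighting_def Suc_le_eq)
  \<comment> \<open>\<open>floor_exponent w\<close> is onto, with \<open>weight_exponent w\<close>
    as a section, so preimages determine the sets.\<close>
  have inj: "{b. floor_exponent w b \<in> C} = {b. floor_exponent w b \<in> D} \<longleftrightarrow> C = D"
    for C D :: "('n \<Rightarrow>\<^sub>0 nat) set"
  proof
    assume eq: "{b. floor_exponent w b \<in> C} = {b. floor_exponent w b \<in> D}"
    have "a \<in> C \<longleftrightarrow> a \<in> D" for a
      using eq floor_weight_exponent[OF w, of a] by (metis mem_Collect_eq)
    then show "C = D" by blast
  qed simp
  show ?thesis
    unfolding simis_ideal_iff[OF J u1(1)] simis_ideal_iff[OF J u1(2)]
    unfolding sym_exps_weighted[OF u] sum_power_weighted[OF w up_closed_sym_exps] inj ..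
qed

section \<open>Uniqueness of the weights and of the squarefree ideal\<close>

text \<open>The probe \<open>b c\<close> is zero on \<open>A j\<close> except for \<open>c\<close>
  at \<open>i\<close>; outside \<open>A j\<close> it is large enough for all other components under
  both families of weights, hence the sum of \<open>u\<close> and \<open>v\<close>. Membership then
  tests only whether \<open>c\<close> reaches the weight at \<open>i\<close>, and equal thresholds
  are equal weights.\<close>

lemma sym_exps_weights_unique:
  fixes A :: "nat \<Rightarrow> 'n::finite set"
  assumes J: "finite J" "incomparable J A"
    and u: "\<forall>j\<in>J. \<forall>i\<in>A j. u j i \<ge> 1" and v: "\<forall>j\<in>J. \<forall>i\<in>A j. v j i \<ge> 1"
    and eq: "sym_exps J A u 1 = sym_exps J A v 1" and j: "j \<in> J" "i \<in> A j"
  shows "u j i = v j i"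
proof -
  define b where "b c = Abs_poly_mapping
    (\<lambda>i'. if i' = i then c else if i' \<in> A j then 0 else \<Sum>k\<in>J. u k i' + v k i')" for c
  have *: "b c \<in> sym_exps J A x 1 \<longleftrightarrow> x j i \<le> c"
    if x: "\<forall>j\<in>J. \<forall>i\<in>A j. x j i \<ge> 1" "\<And>k i. x k i \<le> u k i + v k i" for x c
  proof -
    have "b c \<in> irr_exps (A k) (x k) 1" if k: "k \<in> J" "k \<noteq> j" for k
    proof -
      obtain p where p: "p \<in> A k" "p \<notin> A j"
        using J(2) j(1) k unfolding incomparable_def by blast
      have "u k p + v k p \<le> (\<Sum>k\<in>J. u k p + v k p)"
        using J(1) k(1) by (intro member_le_sum) auto
      then have "x k p \<le> Poly_Mapping.lookup (b c) p"
        using x(2)[of k p] p(2) j(2) by (auto simp: b_def intro: order_trans)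
      then show ?thesis
        using irr_exps_1_iff[of "A k" "x k" "b c"] x(1) k(1) p(1) by auto
    qed
    then have "b c \<in> sym_exps J A x 1 \<longleftrightarrow> b c \<in> irr_exps (A j) (x j) 1"
      using j(1) by (auto simp: sym_exps_def)
    also have "\<dots> \<longleftrightarrow> (\<exists>i'\<in>A j. x j i' \<le> Poly_Mapping.lookup (b c) i')"
      using irr_exps_1_iff x(1) j(1) by blast
    also have "\<dots> \<longleftrightarrow> x j i \<le> c"
      using x(1) j by (force simp: b_def)
    finally show ?thesis .
  qed
  have "u j i \<le> c \<longleftrightarrow> v j i \<le> c" for c
    using *[OF u, of c] *[OF v, of c] eq by simp
  then show ?thesis
    by (meson order_antisym order_refl)
qed

text \<open>With all weights 1 membership asks only which exponents are positive, so truncating them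
  at 1 yields a squarefree divisor in the same ideal.\<close>

lemma squarefree_monomial_span:
  fixes A :: "nat \<Rightarrow> 'n::finite set"
  shows "squarefree_monomial_ideal (monomial_span (sym_exps J A (\<lambda>_ _. 1) 1) :: ('n, 'k::field) mpoly set)"
proof -
  let ?V = "sym_exps J A (\<lambda>_ _. 1) 1"
  let ?S = "{a \<in> ?V. \<forall>i. Poly_Mapping.lookup a i \<le> 1}"
  have "up_closure ?S = ?V"
  proof (intro equalityI subsetI)
    fix b assume "b \<in> up_closure ?S"
    then obtain a where "a \<in> ?V" "\<And>i. Poly_Mapping.lookup a i \<le> Poly_Mapping.lookup b i"
      by (auto simp: up_closure_iff)
    then show "b \<in> ?V"
      by (rule up_closedD[OF up_closed_sym_exps])
  next
    fix b assume b: "b \<in> ?V"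
    define a where "a = Abs_poly_mapping (\<lambda>i. min 1 (Poly_Mapping.lookup b i))"
    have la: "Poly_Mapping.lookup a i = min 1 (Poly_Mapping.lookup b i)" for i
      by (simp add: a_def)
    have "a \<in> irr_exps (A j) (\<lambda>_. 1) 1" if "j \<in> J" for j
    proof -
      have "b \<in> irr_exps (A j) (\<lambda>_. 1) 1"
        using b that by (auto simp: sym_exps_def)
      then show ?thesis
        using irr_exps_1_iff[of "A j" "\<lambda>_. 1" a] irr_exps_1_iff[of "A j" "\<lambda>_. 1" b] by (simp add: la)
    qed
    then have "a \<in> ?S" by (simp add: sym_exps_def la)
    moreover have "\<forall>i. Poly_Mapping.lookup a i \<le> Poly_Mapping.lookup b i"
      by (simp add: la)
    ultimately show "b \<in> up_closure ?S"
      unfolding up_closure_iff by blast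
  qed
  then show ?thesis
    unfolding squarefree_monomial_ideal_def genideal_xpow
    by (intro exI[of _ ?S]) simp
qed

text \<open>A large power of a monomial of the radical lies in the ideal, and a squarefree
  divisor of that power already divides the monomial.\<close>

lemma squarefree_radical_unique:
  fixes A :: "nat \<Rightarrow> 'n::finite set"
  assumes S: "\<forall>a\<in>S. \<forall>i. Poly_Mapping.lookup a i \<le> 1" and w: "standard_weighting w"
    and U: "sym_exps J A u 1 = {b. floor_exponent w b \<in> up_closure S}"
    and u: "\<forall>j\<in>J. \<forall>i\<in>A j. u j i \<ge> 1" and J: "finite J"
  shows "up_closure S = sym_exps J A (\<lambda>_ _. 1) 1"
proof (intro equalityI subsetI)
  fix a assume "a \<in> up_closure S"
  then have wa: "weight_exponent w a \<in> sym_exps J A u 1"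
    unfolding U mem_Collect_eq floor_weight_exponent[OF w] .
  have "a \<in> irr_exps (A j) (\<lambda>_. 1) 1" if j: "j \<in> J" for j
  proof -
    have "weight_exponent w a \<in> irr_exps (A j) (u j) 1"
      using wa j by (auto simp: sym_exps_def)
    then obtain i where i: "i \<in> A j" "u j i \<le> w i * Poly_Mapping.lookup a i"
      using irr_exps_1_iff[OF bspec[OF u j]] by auto
    then have "1 \<le> Poly_Mapping.lookup a i"
      using u j by (cases "Poly_Mapping.lookup a i") force+
    then show ?thesis
      using irr_exps_1_iff[of "A j" "\<lambda>_. 1" a] i(1) by auto
  qed
  then show "a \<in> sym_exps J A (\<lambda>_ _. 1) 1" by (simp add: sym_exps_def)
next
  fix a assume a: "a \<in> sym_exps J A (\<lambda>_ _. 1) 1"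
  define b where "b = Abs_poly_mapping (\<lambda>i. (\<Sum>j\<in>J. u j i) * Poly_Mapping.lookup a i)"
  have lb: "Poly_Mapping.lookup b i = (\<Sum>j\<in>J. u j i) * Poly_Mapping.lookup a i" for i
    by (simp add: b_def)
  have "b \<in> irr_exps (A j) (u j) 1" if j: "j \<in> J" for j
  proof -
    have "a \<in> irr_exps (A j) (\<lambda>_. 1) 1"
      using a j by (auto simp: sym_exps_def)
    then obtain i where i: "i \<in> A j" "1 \<le> Poly_Mapping.lookup a i"
      using irr_exps_1_iff[of "A j" "\<lambda>_. 1" a] by auto
    have "u j i \<le> (\<Sum>j\<in>J. u j i)"
      using J j by (intro member_le_sum) auto
    then have "u j i \<le> Poly_Mapping.lookup b i"
      using mult_le_mono[OF _ i(2), of "u j i"] by (simp add: lb)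
    then show ?thesis
      using irr_exps_1_iff[OF bspec[OF u j]] i(1) by blast
  qed
  then have "floor_exponent w b \<in> up_closure S"
    using U by (auto simp: sym_exps_def)
  then obtain s where s: "s \<in> S" "\<And>i. Poly_Mapping.lookup s i \<le> Poly_Mapping.lookup b i div w i"
    by (auto simp: up_closure_iff)
  have "Poly_Mapping.lookup s i \<le> Poly_Mapping.lookup a i" for i
    using S s(1) s(2)[of i] by (cases "Poly_Mapping.lookup a i") (auto simp: lb intro: order_trans)
  then show "a \<in> up_closure S"
    using s(1) by (auto simp: up_closure_iff)
qed

section \<open>From the given decomposition to sets of exponents\<close>

text \<open>Irredundancy yields a polynomial in all components but the \<open>k\<close>-th; one of
  its terms has the same property, so the prime of \<open>A k\<close> is associated. If another
  \<open>A j\<close> were contained in \<open>A k\<close>, the distinct radicals would make that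
  prime embedded.\<close>

lemma minimal_irreducible_decompositionD:
  fixes I :: "('n::{finite,linorder}, 'k::field) mpoly set"
  assumes "minimal_irreducible_decomposition I r A u"
  shows "\<forall>j\<in>{1..r}. \<forall>i\<in>A j. u j i \<ge> 1"
    and "I = monomial_span (sym_exps {1..r} A u 1)"
    and "embedded_primes I = {} \<Longrightarrow> incomparable {1..r} A"
proof -
  let ?q = "\<lambda>j. pure_power_ideal (A j) (u j) :: ('n, 'k) mpoly set"
  show u: "\<forall>j\<in>{1..r}. \<forall>i\<in>A j. u j i \<ge> 1"
    using assms by (simp add: minimal_irreducible_decomposition_def)
  have q: "?q j = monomial_span (irr_exps (A j) (u j) 1)" if "j \<in> {1..r}" for j
    using pure_power_ideal_eq[OF bspec[OF u that]] .
  have Iq: "I = (\<Inter>j\<in>{1..r}. ?q j)"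
    using assms unfolding minimal_irreducible_decomposition_def by blast
  also have "\<dots> = (\<Inter>j\<in>{1..r}. monomial_span (irr_exps (A j) (u j) 1))"
    by (rule INF_cong) (use q in auto)
  also have "\<dots> = monomial_span (sym_exps {1..r} A u 1)"
    by (auto simp: monomial_span_def sym_exps_def)
  finally show I: "I = monomial_span (sym_exps {1..r} A u 1)" .
  have assoc: "(monomial_span (irr_exps (A k) (\<lambda>_. 1) 1) :: ('n, 'k) mpoly set) \<in> associated_primes I"
    if k: "k \<in> {1..r}" for k
  proof -
    have "I \<noteq> (\<Inter>j\<in>{1..r} - {k}. ?q j)"
      using assms k unfolding minimal_irreducible_decomposition_def by blast
    moreover have "I \<subseteq> (\<Inter>j\<in>{1..r} - {k}. ?q j)"
      unfolding Iq by auto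
    ultimately obtain f where f: "\<And>j. j \<in> {1..r} - {k} \<Longrightarrow> f \<in> ?q j" "f \<notin> I"
      by blast
    then have "f \<notin> ?q k"
      unfolding Iq using k by blast
    then obtain b where b: "b \<in> Poly_Mapping.keys f" "b \<notin> irr_exps (A k) (u k) 1"
      unfolding q[OF k] monomial_span_def by blast
    moreover have "b \<in> sym_exps ({1..r} - {k}) A u 1"
      unfolding sym_exps_def
    proof
      fix j assume j: "j \<in> {1..r} - {k}"
      then show "b \<in> irr_exps (A j) (u j) 1"
        using f(1)[OF j] q[of j] b(1) unfolding monomial_span_def by blast
    qed
    ultimately show ?thesis
      unfolding I by (intro associated_primeI[OF u k])
  qed
  show "incomparable {1..r} A" if emb: "embedded_primes I = {}"
    unfolding incomparable_def
  proof (intro ballI impI notI)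
    fix j k assume jk: "j \<in> {1..r}" "k \<in> {1..r}" "j \<noteq> k" "A j \<subseteq> A k"
    let ?p = "\<lambda>j. monomial_span (irr_exps (A j) (\<lambda>_. 1) 1) :: ('n, 'k) mpoly set"
    have "radical (?q j) \<noteq> radical (?q k)"
      using assms jk(1-3) unfolding minimal_irreducible_decomposition_def inj_on_def by blast
    then have "?p j \<noteq> ?p k"
      using radical_pure_power_ideal[OF bspec[OF u jk(1)], where 'k = 'k]
        radical_pure_power_ideal[OF bspec[OF u jk(2)], where 'k = 'k] by simp
    moreover have "?p j \<subseteq> ?p k"
      using jk(4) unfolding subset_iff variable_span_iff by meson
    ultimately have "?p k \<in> embedded_primes I"
      unfolding embedded_primes_def using assoc[OF jk(1)] assoc[OF jk(2)] by blast
    then show False using emb by simp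
  qed
qed

theorem theorem4p7:
  fixes I :: "('n::{finite,linorder}, 'k::field) mpoly set"
    and r :: nat and A :: "nat \<Rightarrow> 'n set" and u :: "nat \<Rightarrow> 'n \<Rightarrow> nat"
  assumes "monomial_ideal I" and "I \<noteq> {0}" and "I \<noteq> UNIV"
    and "embedded_primes I = {}"
    and "minimal_irreducible_decomposition I r A u"
    and "\<forall>(k, l) \<in> weight_conflicts r A u. \<forall>j \<in> {1..r} - {k, l}. \<not> A j \<subseteq> A k \<union> A l"
  shows "simis_ideal I \<longleftrightarrow>
    (\<exists>(J :: ('n, 'k) mpoly set) w. squarefree_monomial_ideal J \<and> simis_ideal J \<and>
       standard_weighting w \<and> I = weighted_ideal w J)"
proof
  define V where "V = sym_exps {1..r} A (\<lambda>_ _. 1) 1"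
  have J: "finite {1..r}" "incomparable {1..r} A" and u: "\<forall>j\<in>{1..r}. \<forall>i\<in>A j. u j i \<ge> 1"
    and I: "I = monomial_span (sym_exps {1..r} A u 1)"
    using minimal_irreducible_decompositionD[OF assms(5)] assms(4) by simp_all
  {
    assume simis: "simis_ideal I"
    have agree: "u k i = u l i" if kl: "k \<in> {1..r}" "l \<in> {1..r}" and i: "i \<in> A k" "i \<in> A l" for k l i
    proof (rule ccontr)
      assume "u k i \<noteq> u l i"
      then obtain k' l' where kl': "k' \<in> {1..r}" "l' \<in> {1..r}" "i \<in> A k'" "i \<in> A l'" "u k' i < u l' i"
        using kl i by (metis nat_neq_iff)
      then have "k' \<noteq> l'" by auto
      \<comment> \<open>\<open>weight_conflicts\<close> orders pairs by index, while
        \<open>k'\<close> and \<open>l'\<close> are ordered by their weight at \<open>i\<close>; the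
        condition on the remaining components is symmetric in the two.\<close>
      then have "(k', l') \<in> weight_conflicts r A u \<or> (l', k') \<in> weight_conflicts r A u"
        using kl' unfolding weight_conflicts_def by (cases k' l' rule: linorder_cases) force+
      then have "\<forall>j\<in>{1..r} - {k', l'}. \<not> A j \<subseteq> A k' \<union> A l'"
        using assms(6) by (fastforce simp: Un_commute insert_commute)
      then have "sym_exps {1..r} A u 2 \<noteq> sum_power (sym_exps {1..r} A u 1) 2"
        by (rule conflict_symbolic_square[OF J u kl'(1,2) \<open>k' \<noteq> l'\<close> kl'(3-5)])
      then show False
        using simis one_le_numeral unfolding I simis_ideal_iff[OF J u] by blast
    qed
    \<comment> \<open>A variable in no component gets weight 1 to keep the weighting positive;
      elsewhere \<open>agree\<close> makes the value independent of the chosen component.\<close>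
    define w where "w i = (if \<exists>j\<in>{1..r}. i \<in> A j then u (SOME j. j \<in> {1..r} \<and> i \<in> A j) i else 1)" for i
    have w_eq: "\<forall>j\<in>{1..r}. \<forall>i\<in>A j. u j i = w i"
    proof (intro ballI)
      fix j i assume ji: "j \<in> {1..r}" "i \<in> A j"
      then have "(SOME j. j \<in> {1..r} \<and> i \<in> A j) \<in> {1..r} \<and> i \<in> A (SOME j. j \<in> {1..r} \<and> i \<in> A j)"
        by (intro someI[of "\<lambda>j. j \<in> {1..r} \<and> i \<in> A j" j] conjI)
      then have "u j i = u (SOME j. j \<in> {1..r} \<and> i \<in> A j) i"
        using agree ji by blast
      then show "u j i = w i"
        using ji unfolding w_def by auto
    qed
    have "w i > 0" for i
    proof (cases "\<exists>j\<in>{1..r}. i \<in> A j")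
      case True
      then show ?thesis using w_eq u by (force simp: Suc_le_eq)
    next
      case False
      then show ?thesis unfolding w_def by simp
    qed
    then have w: "standard_weighting w" by (simp add: standard_weighting_def)
    have "I = weighted_ideal w (monomial_span V)"
      unfolding I V_def weighted_ideal_monomial_span[OF w up_closed_sym_exps]
      by (simp only: sym_exps_weighted[OF w_eq])
    moreover have "simis_ideal (monomial_span V :: ('n, 'k) mpoly set)"
      using simis simis_ideal_weighted[OF J w w_eq] unfolding I V_def by blast
    moreover have "squarefree_monomial_ideal (monomial_span V :: ('n, 'k) mpoly set)"
      unfolding V_def by (rule squarefree_monomial_span)
    ultimately show "\<exists>(J :: ('n, 'k) mpoly set) w. squarefree_monomial_ideal J \<and> simis_ideal J \<and>
       standard_weighting w \<and> I = weighted_ideal w J"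
      using w by blast
  next
    assume "\<exists>(J :: ('n, 'k) mpoly set) w. squarefree_monomial_ideal J \<and> simis_ideal J \<and>
       standard_weighting w \<and> I = weighted_ideal w J"
    then obtain S w where S: "\<forall>a\<in>S. \<forall>i. Poly_Mapping.lookup a i \<le> 1"
      and simis: "simis_ideal (monomial_span (up_closure S) :: ('n, 'k) mpoly set)"
      and w: "standard_weighting w"
      and Iw: "I = weighted_ideal w (monomial_span (up_closure S))"
      unfolding squarefree_monomial_ideal_def genideal_xpow by blast
    have U: "sym_exps {1..r} A u 1 = {b. floor_exponent w b \<in> up_closure S}"
      using Iw unfolding I weighted_ideal_monomial_span[OF w up_closed_up_closure] by simp
    have "up_closure S = V"
      unfolding V_def by (rule squarefree_radical_unique[OF S w U u J(1)])
    \<comment> \<open>\<open>I\<close> now has two descriptions over the same sets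
      \<open>A j\<close>, one with the weights \<open>u\<close> and one with \<open>w\<close>.
      Uniqueness of weights then makes \<open>simis_ideal_weighted\<close> applicable.\<close>
    have "sym_exps {1..r} A u 1 = sym_exps {1..r} A (\<lambda>_. w) 1"
      unfolding U \<open>up_closure S = V\<close> V_def using sym_exps_weighted[of "{1..r}" A "\<lambda>_. w" w 1] by simp
    moreover have "\<forall>j\<in>{1..r}. \<forall>i\<in>A j. w i \<ge> 1"
      using w by (auto simp: standard_weighting_def Suc_le_eq)
    ultimately have "\<forall>j\<in>{1..r}. \<forall>i\<in>A j. u j i = w i"
      using sym_exps_weights_unique[OF J u, of "\<lambda>_. w"] by blast
    then show "simis_ideal I"
      using simis_ideal_weighted[OF J w] simis unfolding I \<open>up_closure S = V\<close> V_def by blast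
  }
qed

end
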